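(* Let $A$ and $B$ be finite-dimensional quantum systems of dimensions $d_A$ and $d_B$ with fully degenerate local Hamiltonians, so that the Gibbs state of $AB$ is the maximally mixed state $\mathbb{1}_{AB}/(d_Ad_B)$. Let $\mathrm{GLOCC}$ be the set of LOCC protocols $\Lambda$ on $AB$ with $\Lambda[\mathbb{1}_{AB}/(d_Ad_B)]=\mathbb{1}_{AB}/(d_Ad_B)$, and for a quantum state $\rho^{AB}$ define $$F_{\max}(\rho^{AB})=\max_{\Lambda\in\mathrm{GLOCC}}\langle 00|\Lambda[\rho^{AB}]|00\rangle .$$ Then for every quantum state $\rho^{AB}$, $$F_{\max}(\rho^{AB})=\max_{U_A,V_B}\langle 00|\,(U_A\otimes V_B)\,\rho^{AB}\,(U_A^\dagger\otimes V_B^\dagger)\,|00\rangle ,$$ where the maximum is over all unitaries $U_A$ on $A$ and $V_B$ on $B$.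
   Context: $|00\rangle=|0\rangle^A\otimes|0\rangle^B$, where $|0\rangle$ denotes a fixed normalized state vector (the local ground state) of each system. LOCC (local operations and classical communication) protocols are the completely positive trace-preserving maps on $AB$ (here with the same input and output space) realizable by sequences of local quantum operations of the two parties, Alice (holding $A$) and Bob (holding $B$), where measurement outcomes may be classically communicated in both directions and later local operations may depend on them. In general, for local Hamiltonians $H_A,H_B$ and inverse temperature $\beta$, an LOCC protocol $\Lambda$ is called Gibbs-preserving (GLOCC) if $\Lambda[\gamma]=\gamma$, where $\gamma=\gamma^A\otimes\gamma^B$ and $\gamma^X=e^{-\beta H_X}/\mathrm{Tr}[e^{-\beta H_X}]$. A Hamiltonian is fully degenerate if it is a multiple of the identity, in which case its Gibbs state is maximally mixed. *)

theory Defs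
  imports "Jordan_Normal_Form.Schur_Decomposition"
begin

text \<open>
  States and operators are complex matrices with explicit dimensions, since the local systems may
  change dimension in the course of an LOCC protocol. The composite of systems of dimensions
  \<open>a\<close> and \<open>b\<close> has dimension \<open>a * b\<close>, and the basis vector \<open>|i\<rangle> \<otimes> |j\<rangle>\<close> has index \<open>i * b + j\<close>.
\<close>

definition tensor_vec :: "complex vec \<Rightarrow> complex vec \<Rightarrow> complex vec" where
  "tensor_vec v w = vec (dim_vec v * dim_vec w)
     (\<lambda>r. v $ (r div dim_vec w) * w $ (r mod dim_vec w))"

definition tensor_mat :: "complex mat \<Rightarrow> complex mat \<Rightarrow> complex mat" where
  "tensor_mat A B = mat (dim_row A * dim_row B) (dim_col A * dim_col B)
     (\<lambda>(r, c). A $$ (r div dim_row B, c div dim_col B) * B $$ (r mod dim_row B, c mod dim_col B))"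

definition mat_trace :: "complex mat \<Rightarrow> complex" where
  "mat_trace A = (\<Sum>i<dim_row A. A $$ (i, i))"

definition mat_sum :: "nat \<Rightarrow> nat \<Rightarrow> (nat \<Rightarrow> complex mat) \<Rightarrow> complex mat" where
  "mat_sum d n F = mat d d (\<lambda>(r, c). \<Sum>i<n. F i $$ (r, c))"

definition unitary_mat :: "nat \<Rightarrow> complex mat \<Rightarrow> bool" where
  "unitary_mat n U \<longleftrightarrow>
     U \<in> carrier_mat n n \<and> U * mat_adjoint U = 1\<^sub>m n \<and> mat_adjoint U * U = 1\<^sub>m n"

definition unit_vector :: "nat \<Rightarrow> complex vec \<Rightarrow> bool" where
  "unit_vector n v \<longleftrightarrow> v \<in> carrier_vec n \<and> v \<bullet>c v = 1"

text \<open>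
  The order on the complex numbers is the one in which \<open>0 \<le> z\<close> means that \<open>z\<close> is real and
  nonnegative; in particular \<open>psd n A\<close> forces \<open>A\<close> to be Hermitian.
\<close>

definition psd :: "nat \<Rightarrow> complex mat \<Rightarrow> bool" where
  "psd n A \<longleftrightarrow> A \<in> carrier_mat n n \<and> (\<forall>v\<in>carrier_vec n. 0 \<le> (A *\<^sub>v v) \<bullet>c v)"

definition quantum_state :: "nat \<Rightarrow> complex mat \<Rightarrow> bool" where
  "quantum_state n \<rho> \<longleftrightarrow> psd n \<rho> \<and> mat_trace \<rho> = 1"

definition maximally_mixed :: "nat \<Rightarrow> complex mat" where
  "maximally_mixed d = (1 / of_nat d) \<cdot>\<^sub>m 1\<^sub>m d"

text \<open>
  A map \<open>E\<close> from \<open>m \<times> m\<close> matrices to \<open>m' \<times> m'\<close> matrices acts on one factor of a composite system as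
  \<open>E \<otimes> id\<close> or \<open>id \<otimes> E\<close>, the other factor having dimension \<open>k\<close>: it is applied to each of the
  \<open>m \<times> m\<close> blocks obtained by fixing the row and column index of the other factor.
\<close>

definition act_left :: "nat \<Rightarrow> nat \<Rightarrow> nat \<Rightarrow> (complex mat \<Rightarrow> complex mat) \<Rightarrow> complex mat \<Rightarrow> complex mat"
  where "act_left m m' k E X = mat (m' * k) (m' * k)
     (\<lambda>(r, c). E (mat m m (\<lambda>(i, j). X $$ (i * k + r mod k, j * k + c mod k))) $$ (r div k, c div k))"

definition act_right :: "nat \<Rightarrow> nat \<Rightarrow> nat \<Rightarrow> (complex mat \<Rightarrow> complex mat) \<Rightarrow> complex mat \<Rightarrow> complex mat"
  where "act_right k m m' E X = mat (k * m') (k * m')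
     (\<lambda>(r, c). E (mat m m (\<lambda>(i, j). X $$ ((r div m') * m + i, (c div m') * m + j)))
                 $$ (r mod m', c mod m'))"

lemma act_left_tensor:
  assumes A: "A \<in> carrier_mat m m" and B: "B \<in> carrier_mat k k"
    and E: "E A \<in> carrier_mat m' m'"
    and scale: "\<And>c X. X \<in> carrier_mat m m \<Longrightarrow> E X \<in> carrier_mat m' m' \<and> E (c \<cdot>\<^sub>m X) = c \<cdot>\<^sub>m E X"
  shows "act_left m m' k E (tensor_mat A B) = tensor_mat (E A) B"
proof (rule eq_matI)
  fix r c assume "r < dim_row (tensor_mat (E A) B)" "c < dim_col (tensor_mat (E A) B)"
  then have r: "r < m' * k" and c: "c < m' * k" using E B by (auto simp: tensor_mat_def)
  then have k: "0 < k" by (cases k) auto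
  have bound: "i * k + q < m * k" if "i < m" "q < k" for i q
  proof -
    have "i * k + q < Suc i * k" using that by simp
    also have "\<dots> \<le> m * k" using that by (intro mult_le_mono1) auto
    finally show ?thesis .
  qed
  have "mat m m (\<lambda>(i, j). tensor_mat A B $$ (i * k + r mod k, j * k + c mod k))
        = B $$ (r mod k, c mod k) \<cdot>\<^sub>m A"
    using A B k by (intro eq_matI) (auto simp: tensor_mat_def bound)
  moreover have "r div k < m'" "c div k < m'"
    using r c by (auto intro: less_mult_imp_div_less)
  ultimately show "act_left m m' k E (tensor_mat A B) $$ (r, c) = tensor_mat (E A) B $$ (r, c)"
    using r c k carrier_matD[OF A] carrier_matD[OF B] carrier_matD[OF E]
      scale[OF A, of "B $$ (r mod k, c mod k)"]
    by (simp add: act_left_def tensor_mat_def)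
qed (use E B in \<open>auto simp: act_left_def tensor_mat_def\<close>)

lemma act_right_tensor:
  assumes A: "A \<in> carrier_mat k k" and B: "B \<in> carrier_mat m m"
    and E: "E B \<in> carrier_mat m' m'"
    and scale: "\<And>c X. X \<in> carrier_mat m m \<Longrightarrow> E X \<in> carrier_mat m' m' \<and> E (c \<cdot>\<^sub>m X) = c \<cdot>\<^sub>m E X"
  shows "act_right k m m' E (tensor_mat A B) = tensor_mat A (E B)"
proof (rule eq_matI)
  fix r c assume "r < dim_row (tensor_mat A (E B))" "c < dim_col (tensor_mat A (E B))"
  then have r: "r < k * m'" and c: "c < k * m'" using E A by (auto simp: tensor_mat_def)
  then have m': "0 < m'" by (cases m') auto
  have rc: "r div m' < k" "c div m' < k"
    using r c by (auto intro: less_mult_imp_div_less)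
  have bound: "q * m + i < k * m" if "i < m" "q < k" for i q
  proof -
    have "q * m + i < Suc q * m" using that by simp
    also have "\<dots> \<le> k * m" using that by (intro mult_le_mono1) auto
    finally show ?thesis .
  qed
  have "mat m m (\<lambda>(i, j). tensor_mat A B $$ ((r div m') * m + i, (c div m') * m + j))
        = A $$ (r div m', c div m') \<cdot>\<^sub>m B"
    using A B rc by (intro eq_matI) (auto simp: tensor_mat_def bound)
  then show "act_right k m m' E (tensor_mat A B) $$ (r, c) = tensor_mat A (E B) $$ (r, c)"
    using r c m' carrier_matD[OF A] carrier_matD[OF B] carrier_matD[OF E]
      scale[OF B, of "A $$ (r div m', c div m')"]
    by (simp add: act_right_def tensor_mat_def)
qed (use E A in \<open>auto simp: act_right_def tensor_mat_def\<close>)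

definition linear_mat_map :: "nat \<Rightarrow> nat \<Rightarrow> (complex mat \<Rightarrow> complex mat) \<Rightarrow> bool" where
  "linear_mat_map m m' E \<longleftrightarrow>
     (\<forall>X\<in>carrier_mat m m. E X \<in> carrier_mat m' m') \<and>
     (\<forall>X\<in>carrier_mat m m. \<forall>Y\<in>carrier_mat m m. E (X + Y) = E X + E Y) \<and>
     (\<forall>c. \<forall>X\<in>carrier_mat m m. E (c \<cdot>\<^sub>m X) = c \<cdot>\<^sub>m E X)"

definition completely_positive :: "nat \<Rightarrow> nat \<Rightarrow> (complex mat \<Rightarrow> complex mat) \<Rightarrow> bool" where
  "completely_positive m m' E \<longleftrightarrow>
     linear_mat_map m m' E \<and>
     (\<forall>k X. psd (m * k) X \<longrightarrow> psd (m' * k) (act_left m m' k E X))"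

text \<open>
  A local quantum operation with classical outcome \<open>i < n\<close>: outcome \<open>i\<close> transforms the input \<open>X\<close>
  into the unnormalised state \<open>E i X\<close> of a system of dimension \<open>d i\<close>.
\<close>

definition instrument :: "nat \<Rightarrow> nat \<Rightarrow> (nat \<Rightarrow> nat) \<Rightarrow> (nat \<Rightarrow> complex mat \<Rightarrow> complex mat) \<Rightarrow> bool"
  where "instrument m n d E \<longleftrightarrow>
     (\<forall>i<n. 0 < d i \<and> completely_positive m (d i) (E i)) \<and>
     (\<forall>X\<in>carrier_mat m m. (\<Sum>i<n. mat_trace (E i X)) = mat_trace X)"

text \<open>
  \<open>locc dA dB a b \<Lambda>\<close>: the map \<open>\<Lambda>\<close> from operators on local dimensions \<open>a, b\<close> to operators on local
  dimensions \<open>dA, dB\<close> is realised by finitely many rounds of local operations, in which either party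
  acts and communicates the outcome \<open>i\<close>, and the remaining protocol \<open>L i\<close> may depend on it. Ancillas,
  partial traces and shared randomness are instances of local operations; the sum over \<open>i\<close> discards
  the classical record. Only the values of \<open>\<Lambda>\<close> on matrices of the input dimension matter.
\<close>

inductive locc :: "nat \<Rightarrow> nat \<Rightarrow> nat \<Rightarrow> nat \<Rightarrow> (complex mat \<Rightarrow> complex mat) \<Rightarrow> bool"
  for dA dB :: nat where
  stop: "locc dA dB dA dB \<Lambda>"
    if "\<And>X. X \<in> carrier_mat (dA * dB) (dA * dB) \<Longrightarrow> \<Lambda> X = X"
| alice: "locc dA dB a b \<Lambda>"
    if "instrument a n a' E"
      and "\<And>i. i < n \<Longrightarrow> locc dA dB (a' i) b (L i)"
      and "\<And>X. X \<in> carrier_mat (a * b) (a * b) \<Longrightarrow>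
             \<Lambda> X = mat_sum (dA * dB) n (\<lambda>i. L i (act_left a (a' i) b (E i) X))"
| bob: "locc dA dB a b \<Lambda>"
    if "instrument b n b' E"
      and "\<And>i. i < n \<Longrightarrow> locc dA dB a (b' i) (L i)"
      and "\<And>X. X \<in> carrier_mat (a * b) (a * b) \<Longrightarrow>
             \<Lambda> X = mat_sum (dA * dB) n (\<lambda>i. L i (act_right a b (b' i) (E i) X))"

definition glocc :: "nat \<Rightarrow> nat \<Rightarrow> (complex mat \<Rightarrow> complex mat) set" where
  "glocc dA dB = {\<Lambda>. locc dA dB dA dB \<Lambda> \<and>
                      \<Lambda> (maximally_mixed (dA * dB)) = maximally_mixed (dA * dB)}"

text \<open>
  \<open>overlap \<psi> X\<close> is \<open>\<langle>\<psi>|X|\<psi>\<rangle>\<close>, which is real whenever \<open>X\<close> is Hermitian.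
\<close>

definition overlap :: "complex vec \<Rightarrow> complex mat \<Rightarrow> real" where
  "overlap \<psi> X = Re ((X *\<^sub>v \<psi>) \<bullet>c \<psi>)"

definition is_maximum :: "real set \<Rightarrow> real \<Rightarrow> bool" where
  "is_maximum S m \<longleftrightarrow> m \<in> S \<and> (\<forall>x\<in>S. x \<le> m)"

text \<open>
  The vectors \<open>v\<close> and \<open>w\<close> are the local ground states. If the maximum does not exist, \<open>F_max\<close> is
  unspecified, so its existence has to be part of any claim about it.
\<close>

definition F_max :: "nat \<Rightarrow> nat \<Rightarrow> complex vec \<Rightarrow> complex vec \<Rightarrow> complex mat \<Rightarrow> real" where
  "F_max dA dB v w \<rho> = (THE m. is_maximum {overlap (tensor_vec v w) (\<Lambda> \<rho>) | \<Lambda>. \<Lambda> \<in> glocc dA dB} m)"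

end

theory Submission
  imports Defs "HOL-Analysis.Function_Topology"
begin

text \<open>
  Call a matrix block positive if its quadratic form is nonnegative on product vectors. Contracting
  one side of a block positive matrix with a fixed vector gives a positive semidefinite matrix, and
  this contraction commutes with a map acting on the other side; hence every LOCC map preserves
  block positivity. If \<open>M\<close> is the maximum of \<open>\<langle>xy|\<rho>|xy\<rangle>\<close> over unit product vectors, which exists by
  compactness, then \<open>M \<cdot> 1 - \<rho>\<close> is block positive. A Gibbs-preserving \<open>\<Lambda>\<close> maps it to
  \<open>M \<cdot> 1 - \<Lambda> \<rho>\<close>, so \<open>\<langle>00|\<Lambda> \<rho>|00\<rangle> \<le> M\<close>. Local unitaries are Gibbs-preserving, and they attain \<open>M\<close>
  because unitaries act transitively on unit vectors.
\<close>

section \<open>Block positivity under LOCC\<close>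

lemma pair_index_less: "i < m \<Longrightarrow> q < k \<Longrightarrow> i * k + q < m * k" for i q m k :: nat
proof -
  assume "i < m" "q < k"
  then have "i * k + q < Suc i * k" by simp
  also have "\<dots> \<le> m * k" using \<open>i < m\<close> by (intro mult_le_mono1) auto
  finally show ?thesis .
qed

text \<open>The range below \<open>m * k\<close> falls into \<open>m\<close> consecutive groups of
  length \<open>k\<close>. This turns a sum over a composite system into sums over the two local
  indices.\<close>

lemma sum_mult_lessThan:
  fixes f :: "nat \<Rightarrow> 'a::comm_monoid_add"
  shows "(\<Sum>r<m * k. f r) = (\<Sum>i<m. \<Sum>q<k. f (i * k + q))"
proof -
  have "(\<Sum>q<k. f (i * k + q)) = sum f {i * k..<i * k + k}" for i
    using sum.shift_bounds_nat_ivl[of f 0 "i * k" k]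
    by (simp add: atLeast0LessThan add.commute)
  then show ?thesis by (simp add: sum.nat_group)
qed

lemma quadratic_form_sum:
  fixes X :: "complex mat"
  assumes "X \<in> carrier_mat n n" "u \<in> carrier_vec n"
  shows "(X *\<^sub>v u) \<bullet>c u = (\<Sum>i<n. \<Sum>j<n. X $$ (i, j) * (u $ j * cnj (u $ i)))"
  using assms by (auto simp: scalar_prod_def atLeast0LessThan sum_distrib_right mult.assoc intro!: sum.cong)

lemma tensor_vec_carrier [simp]:
  "x \<in> carrier_vec a \<Longrightarrow> y \<in> carrier_vec b \<Longrightarrow> tensor_vec x y \<in> carrier_vec (a * b)"
  by (auto simp: tensor_vec_def)

lemma tensor_vec_index:
  assumes "x \<in> carrier_vec a" "y \<in> carrier_vec b" "i < a" "q < b"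
  shows "tensor_vec x y $ (i * b + q) = x $ i * y $ q"
  using assms by (auto simp: tensor_vec_def pair_index_less)

lemma product_form_sum:
  fixes X :: "complex mat"
  assumes X: "X \<in> carrier_mat (a * b) (a * b)" and x: "x \<in> carrier_vec a" and y: "y \<in> carrier_vec b"
  shows "(X *\<^sub>v tensor_vec x y) \<bullet>c tensor_vec x y =
    (\<Sum>i<a. \<Sum>q<b. \<Sum>j<a. \<Sum>p<b.
       X $$ (i * b + q, j * b + p) * (x $ j * y $ p * cnj (x $ i * y $ q)))"
  unfolding quadratic_form_sum[OF X tensor_vec_carrier[OF x y]] sum_mult_lessThan
  by (intro sum.cong refl) (simp add: tensor_vec_index[OF x y])

text \<open>The partial sandwiches \<open>\<langle>y|X|y\<rangle>\<close> and \<open>\<langle>x|X|x\<rangle>\<close> of the second and of the first factor.\<close>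

definition contract_right :: "nat \<Rightarrow> nat \<Rightarrow> complex vec \<Rightarrow> complex mat \<Rightarrow> complex mat" where
  "contract_right a b y X =
     mat a a (\<lambda>(i, j). \<Sum>q<b. \<Sum>p<b. X $$ (i * b + q, j * b + p) * (y $ p * cnj (y $ q)))"

definition contract_left :: "nat \<Rightarrow> nat \<Rightarrow> complex vec \<Rightarrow> complex mat \<Rightarrow> complex mat" where
  "contract_left a b x X =
     mat b b (\<lambda>(q, p). \<Sum>i<a. \<Sum>j<a. X $$ (i * b + q, j * b + p) * (x $ j * cnj (x $ i)))"

text \<open>Links product vectors with ordinary positivity: for fixed \<open>y\<close>,
  nonnegativity of the product form at all \<open>x\<close> says exactly that the contraction is
  \<open>psd\<close>.\<close>

lemma contract_right_form:
  assumes X: "X \<in> carrier_mat (a * b) (a * b)" and x: "x \<in> carrier_vec a" and y: "y \<in> carrier_vec b"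
  shows "(contract_right a b y X *\<^sub>v x) \<bullet>c x = (X *\<^sub>v tensor_vec x y) \<bullet>c tensor_vec x y"
proof -
  have "(contract_right a b y X *\<^sub>v x) \<bullet>c x =
    (\<Sum>i<a. \<Sum>j<a. \<Sum>q<b. \<Sum>p<b.
       X $$ (i * b + q, j * b + p) * (x $ j * y $ p * cnj (x $ i * y $ q)))"
    by (subst quadratic_form_sum[OF _ x])
      (auto simp: contract_right_def sum_distrib_left sum_distrib_right mult_ac intro!: sum.cong)
  also have "\<dots> = (X *\<^sub>v tensor_vec x y) \<bullet>c tensor_vec x y"
    unfolding product_form_sum[OF X x y] by (intro sum.cong refl sum.swap)
  finally show ?thesis .
qed

lemma contract_left_form:
  assumes X: "X \<in> carrier_mat (a * b) (a * b)" and x: "x \<in> carrier_vec a" and y: "y \<in> carrier_vec b"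
  shows "(contract_left a b x X *\<^sub>v y) \<bullet>c y = (X *\<^sub>v tensor_vec x y) \<bullet>c tensor_vec x y"
proof -
  have "(contract_left a b x X *\<^sub>v y) \<bullet>c y =
    (\<Sum>q<b. \<Sum>p<b. \<Sum>i<a. \<Sum>j<a.
       X $$ (i * b + q, j * b + p) * (x $ j * y $ p * cnj (x $ i * y $ q)))"
    by (subst quadratic_form_sum[OF _ y])
      (auto simp: contract_left_def sum_distrib_left sum_distrib_right mult_ac intro!: sum.cong)
  \<comment> \<open>Three exchanges, \<open>p\<close> with \<open>i\<close>, then \<open>q\<close>
    with \<open>i\<close>, then \<open>p\<close> with \<open>j\<close>, lead to the order
    \<open>i, q, j, p\<close> of \<open>product_form_sum\<close>.\<close>
  also have "\<dots> = (\<Sum>q<b. \<Sum>i<a. \<Sum>p<b. \<Sum>j<a.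
       X $$ (i * b + q, j * b + p) * (x $ j * y $ p * cnj (x $ i * y $ q)))"
    by (intro sum.cong refl sum.swap)
  also have "\<dots> = (\<Sum>i<a. \<Sum>q<b. \<Sum>p<b. \<Sum>j<a.
       X $$ (i * b + q, j * b + p) * (x $ j * y $ p * cnj (x $ i * y $ q)))"
    by (rule sum.swap)
  also have "\<dots> = (X *\<^sub>v tensor_vec x y) \<bullet>c tensor_vec x y"
    unfolding product_form_sum[OF X x y] by (intro sum.cong refl sum.swap)
  finally show ?thesis .
qed

section \<open>Contractions commute with maps on the other factor\<close>

lemma linear_mat_map_carrier:
  "linear_mat_map m m' E \<Longrightarrow> X \<in> carrier_mat m m \<Longrightarrow> E X \<in> carrier_mat m' m'"
  by (simp add: linear_mat_map_def)

lemma linear_mat_map_sum: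
  assumes E: "linear_mat_map m m' E" and "finite S"
    and F: "\<And>s. s \<in> S \<Longrightarrow> F s \<in> carrier_mat m m" and rc: "r < m'" "c < m'"
  shows "E (mat m m (\<lambda>ij. \<Sum>s\<in>S. F s $$ ij * w s)) $$ (r, c) = (\<Sum>s\<in>S. E (F s) $$ (r, c) * w s)"
  using \<open>finite S\<close> F
proof (induction S)
  case empty
  \<comment> \<open>Writing the empty sum as a multiple by 0 lets homogeneity show that
    \<open>E\<close> sends it to zero.\<close>
  have eq: "mat m m (\<lambda>ij. \<Sum>s\<in>{}. F s $$ ij * w s) = 0 \<cdot>\<^sub>m 0\<^sub>m m m" by (intro eq_matI) auto
  have "E (0 \<cdot>\<^sub>m 0\<^sub>m m m) = 0 \<cdot>\<^sub>m E (0\<^sub>m m m)" "E (0\<^sub>m m m) \<in> carrier_mat m' m'"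
    using E unfolding linear_mat_map_def by (blast intro: zero_carrier_mat)+
  then have "E (0 \<cdot>\<^sub>m 0\<^sub>m m m) $$ (r, c) = 0" using rc by (simp del: smult_zero_mat)
  then show ?case unfolding eq by simp
next
  case (insert t S)
  let ?G = "mat m m (\<lambda>ij. \<Sum>s\<in>S. F s $$ ij * w s)"
  have Ft: "F t \<in> carrier_mat m m" using insert by auto
  have eq: "mat m m (\<lambda>ij. \<Sum>s\<in>insert t S. F s $$ ij * w s) = w t \<cdot>\<^sub>m F t + ?G"
    using insert.hyps Ft by (intro eq_matI) (auto simp: mult.commute)
  have "E (w t \<cdot>\<^sub>m F t + ?G) = w t \<cdot>\<^sub>m E (F t) + E ?G"
    using E Ft by (simp add: linear_mat_map_def)
  moreover have "E (F t) \<in> carrier_mat m' m'" "E ?G \<in> carrier_mat m' m'"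
    using E Ft by (simp_all add: linear_mat_map_def)
  ultimately show ?case unfolding eq using rc insert by simp
qed

lemma act_left_carrier [simp]: "act_left m m' k E X \<in> carrier_mat (m' * k) (m' * k)"
  by (simp add: act_left_def)

lemma act_right_carrier [simp]: "act_right k m m' E X \<in> carrier_mat (k * m') (k * m')"
  by (simp add: act_right_def)

text \<open>The contraction is a linear combination of the \<open>m \<times> m\<close> blocks to
  which \<open>act_left\<close> applies \<open>E\<close>, with weights given by \<open>y\<close>.
  Linearity therefore pulls \<open>E\<close> out of the sum.\<close>

lemma contract_right_act_left:
  assumes E: "linear_mat_map m m' E"
  shows "contract_right m' k y (act_left m m' k E X) = E (contract_right m k y X)"
proof (rule eq_matI)
  have c: "E (contract_right m k y X) \<in> carrier_mat m' m'"
    by (rule linear_mat_map_carrier[OF E]) (simp add: contract_right_def)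
  then show "dim_row (contract_right m' k y (act_left m m' k E X)) = dim_row (E (contract_right m k y X))"
    "dim_col (contract_right m' k y (act_left m m' k E X)) = dim_col (E (contract_right m k y X))"
    by (auto simp: contract_right_def)
  fix r c assume "r < dim_row (E (contract_right m k y X))" "c < dim_col (E (contract_right m k y X))"
  with c have rc: "r < m'" "c < m'" by auto
  \<comment> \<open>The block of \<open>X\<close> with the indices \<open>q, p\<close> of the second
    factor fixed.\<close>
  define F where "F = (\<lambda>(q, p). mat m m (\<lambda>(i, j). X $$ (i * k + q, j * k + p)))"
  let ?w = "\<lambda>(q, p). y $ p * cnj (y $ q)"
  have "contract_right m k y X = mat m m (\<lambda>ij. \<Sum>s\<in>{..<k} \<times> {..<k}. F s $$ ij * ?w s)"
    by (intro eq_matI) (auto simp: contract_right_def F_def sum.cartesian_product intro!: sum.cong)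
  then have "E (contract_right m k y X) $$ (r, c) = (\<Sum>s\<in>{..<k} \<times> {..<k}. E (F s) $$ (r, c) * ?w s)"
    by (simp only:) (rule linear_mat_map_sum[OF E _ _ rc], auto simp: F_def)
  also have "\<dots> = contract_right m' k y (act_left m m' k E X) $$ (r, c)"
    using rc by (auto simp: contract_right_def F_def act_left_def sum.cartesian_product
        pair_index_less intro!: sum.cong)
  finally show "contract_right m' k y (act_left m m' k E X) $$ (r, c) = E (contract_right m k y X) $$ (r, c)"
    by simp
qed

lemma contract_left_act_right:
  assumes E: "linear_mat_map m m' E"
  shows "contract_left k m' x (act_right k m m' E X) = E (contract_left k m x X)"
proof (rule eq_matI)
  have c: "E (contract_left k m x X) \<in> carrier_mat m' m'"
    by (rule linear_mat_map_carrier[OF E]) (simp add: contract_left_def)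
  then show "dim_row (contract_left k m' x (act_right k m m' E X)) = dim_row (E (contract_left k m x X))"
    "dim_col (contract_left k m' x (act_right k m m' E X)) = dim_col (E (contract_left k m x X))"
    by (auto simp: contract_left_def)
  fix r c assume "r < dim_row (E (contract_left k m x X))" "c < dim_col (E (contract_left k m x X))"
  with c have rc: "r < m'" "c < m'" by auto
  \<comment> \<open>The indices of the first factor are fixed now, so these blocks are contiguous
    submatrices of \<open>X\<close>.\<close>
  define F where "F = (\<lambda>(i, j). mat m m (\<lambda>(q, p). X $$ (i * m + q, j * m + p)))"
  let ?w = "\<lambda>(i, j). x $ j * cnj (x $ i)"
  have "contract_left k m x X = mat m m (\<lambda>qp. \<Sum>s\<in>{..<k} \<times> {..<k}. F s $$ qp * ?w s)"
    by (intro eq_matI) (auto simp: contract_left_def F_def sum.cartesian_product intro!: sum.cong)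
  then have "E (contract_left k m x X) $$ (r, c) = (\<Sum>s\<in>{..<k} \<times> {..<k}. E (F s) $$ (r, c) * ?w s)"
    by (simp only:) (rule linear_mat_map_sum[OF E _ _ rc], auto simp: F_def)
  also have "\<dots> = contract_left k m' x (act_right k m m' E X) $$ (r, c)"
    using rc by (auto simp: contract_left_def F_def act_right_def sum.cartesian_product
        pair_index_less intro!: sum.cong)
  finally show "contract_left k m' x (act_right k m m' E X) $$ (r, c) = E (contract_left k m x X) $$ (r, c)"
    by simp
qed

section \<open>Block positivity through single rounds and whole protocols\<close>

text \<open>The cone dual to the separable matrices. It contains the positive semidefinite ones, in
  general strictly: \<open>M \<cdot> 1 - \<rho>\<close> belongs to it even if \<open>\<rho>\<close>
  has an entangled eigenvector with eigenvalue above \<open>M\<close>.\<close>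

definition block_positive :: "nat \<Rightarrow> nat \<Rightarrow> complex mat \<Rightarrow> bool" where
  "block_positive a b X \<longleftrightarrow> X \<in> carrier_mat (a * b) (a * b) \<and>
     (\<forall>x\<in>carrier_vec a. \<forall>y\<in>carrier_vec b. 0 \<le> (X *\<^sub>v tensor_vec x y) \<bullet>c tensor_vec x y)"

text \<open>An ancilla of dimension 1 turns complete positivity into positivity.\<close>

lemma completely_positive_psd:
  assumes E: "completely_positive m m' E" and X: "psd m X"
  shows "psd m' (E X)"
proof -
  have c: "X \<in> carrier_mat m m" "E X \<in> carrier_mat m' m'"
    using E X by (auto simp: completely_positive_def psd_def linear_mat_map_def)
  have "mat m m (\<lambda>(i, j). X $$ (i, j)) = X"
    using c by (intro eq_matI) auto
  then have "act_left m m' 1 E X = E X"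
    using c by (intro eq_matI) (auto simp: act_left_def)
  moreover have "psd (m' * 1) (act_left m m' 1 E X)"
    using E X unfolding completely_positive_def by (metis mult.right_neutral)
  ultimately show ?thesis by simp
qed

text \<open>Contracting with a fixed \<open>y\<close> reduces the claim to positivity of
  \<open>E\<close> on the first system alone.\<close>

lemma block_positive_act_left:
  assumes E: "completely_positive a a' E" and X: "block_positive a b X"
  shows "block_positive a' b (act_left a a' b E X)"
proof -
  have lin: "linear_mat_map a a' E" using E by (simp add: completely_positive_def)
  {
    fix x y :: "complex vec" assume x: "x \<in> carrier_vec a'" and y: "y \<in> carrier_vec b"
    have "psd a (contract_right a b y X)"
      using X y contract_right_form[of X a b _ y]
      by (auto simp: psd_def block_positive_def contract_right_def)
    then have "psd a' (contract_right a' b y (act_left a a' b E X))"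
      using completely_positive_psd[OF E] by (simp add: contract_right_act_left[OF lin])
    then have "0 \<le> (act_left a a' b E X *\<^sub>v tensor_vec x y) \<bullet>c tensor_vec x y"
      using x contract_right_form[OF act_left_carrier x y] by (auto simp: psd_def)
  }
  then show ?thesis by (simp add: block_positive_def)
qed

text \<open>Complete positivity is phrased through \<open>act_left\<close>, yet it serves Bob as
  well: after contraction with \<open>x\<close>, the map \<open>E\<close> acts on a matrix of his
  system alone.\<close>

lemma block_positive_act_right:
  assumes E: "completely_positive b b' E" and X: "block_positive a b X"
  shows "block_positive a b' (act_right a b b' E X)"
proof -
  have lin: "linear_mat_map b b' E" using E by (simp add: completely_positive_def)
  {
    fix x y :: "complex vec" assume x: "x \<in> carrier_vec a" and y: "y \<in> carrier_vec b'"
    have "psd b (contract_left a b x X)"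
      using X x contract_left_form[of X a b x]
      by (auto simp: psd_def block_positive_def contract_left_def)
    then have "psd b' (contract_left a b' x (act_right a b b' E X))"
      using completely_positive_psd[OF E] by (simp add: contract_left_act_right[OF lin])
    then have "0 \<le> (act_right a b b' E X *\<^sub>v tensor_vec x y) \<bullet>c tensor_vec x y"
      using y contract_left_form[OF act_right_carrier x y] by (auto simp: psd_def)
  }
  then show ?thesis by (simp add: block_positive_def)
qed

text \<open>The quadratic form is additive in the matrix, so discarding the classical record stays
  within the cone.\<close>

lemma block_positive_mat_sum:
  assumes F: "\<And>i. i < n \<Longrightarrow> block_positive a b (F i)"
  shows "block_positive a b (mat_sum (a * b) n F)"
proof -
  {
    fix x y :: "complex vec" assume x: "x \<in> carrier_vec a" and y: "y \<in> carrier_vec b"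
    let ?u = "tensor_vec x y" and ?d = "a * b"
    have u: "?u \<in> carrier_vec ?d" using x y by simp
    have "(mat_sum ?d n F *\<^sub>v ?u) \<bullet>c ?u
      = (\<Sum>i<?d. \<Sum>j<?d. \<Sum>l<n. F l $$ (i, j) * (?u $ j * cnj (?u $ i)))"
      by (subst quadratic_form_sum[OF _ u]) (auto simp: mat_sum_def sum_distrib_right)
    also have "\<dots> = (\<Sum>i<?d. \<Sum>l<n. \<Sum>j<?d. F l $$ (i, j) * (?u $ j * cnj (?u $ i)))"
      by (intro sum.cong refl sum.swap)
    also have "\<dots> = (\<Sum>l<n. \<Sum>i<?d. \<Sum>j<?d. F l $$ (i, j) * (?u $ j * cnj (?u $ i)))"
      by (rule sum.swap)
    also have "\<dots> = (\<Sum>l<n. (F l *\<^sub>v ?u) \<bullet>c ?u)"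
      using F by (intro sum.cong refl quadratic_form_sum[OF _ u, symmetric]) (auto simp: block_positive_def)
    also have "\<dots> \<ge> 0"
      using F x y by (intro sum_nonneg) (auto simp: block_positive_def)
    finally have "0 \<le> (mat_sum ?d n F *\<^sub>v ?u) \<bullet>c ?u" .
  }
  then show ?thesis by (simp add: block_positive_def mat_sum_def)
qed

text \<open>Induction on the protocol. \<open>X\<close> is generalised because the remaining
  protocol \<open>L i\<close> acts on the matrix left after the outcome \<open>i\<close>, with
  possibly different local dimensions.\<close>

lemma locc_block_positive:
  assumes "locc dA dB a b \<Lambda>" "block_positive a b X"
  shows "block_positive dA dB (\<Lambda> X)"
  using assms
proof (induction arbitrary: X)
  case (stop \<Lambda>)
  then show ?case by (simp add: block_positive_def)
next
  case (alice a n a' E b L \<Lambda>)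
  have "block_positive dA dB (L i (act_left a (a' i) b (E i) X))" if "i < n" for i
    using alice that by (intro alice.IH block_positive_act_left) (auto simp: instrument_def)
  moreover have "\<Lambda> X = mat_sum (dA * dB) n (\<lambda>i. L i (act_left a (a' i) b (E i) X))"
    using alice by (auto simp: block_positive_def)
  ultimately show ?case by (simp add: block_positive_mat_sum)
next
  case (bob b n b' E a L \<Lambda>)
  have "block_positive dA dB (L i (act_right a b (b' i) (E i) X))" if "i < n" for i
    using bob that by (intro bob.IH block_positive_act_right) (auto simp: instrument_def)
  moreover have "\<Lambda> X = mat_sum (dA * dB) n (\<lambda>i. L i (act_right a b (b' i) (E i) X))"
    using bob by (auto simp: block_positive_def)
  ultimately show ?case by (simp add: block_positive_mat_sum)
qed

section \<open>Linearity of LOCC maps\<close>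

lemma linear_mat_map_act_left:
  assumes E: "linear_mat_map m m' E"
  shows "linear_mat_map (m * k) (m' * k) (act_left m m' k E)"
proof -
  let ?B = "\<lambda>X r c. mat m m (\<lambda>(i, j). X $$ (i * k + r mod k, j * k + c mod k)) :: complex mat"
  \<comment> \<open>An index below \<open>m' * k\<close> exists only for positive \<open>k\<close>;
    then \<open>r mod k < k\<close>, so the entries selected for the block lie inside
    \<open>X\<close>.\<close>
  have pos: "0 < k" if "r < m' * k" for r using that by (cases k) auto
  have carr: "E (?B X r c) \<in> carrier_mat m' m'" for X r c
    using linear_mat_map_carrier[OF E] by auto
  have div: "r div k < m'" if "r < m' * k" for r
    using that by (rule less_mult_imp_div_less)
  have add: "act_left m m' k E (X + Y) = act_left m m' k E X + act_left m m' k E Y"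
    if X: "X \<in> carrier_mat (m * k) (m * k)" and Y: "Y \<in> carrier_mat (m * k) (m * k)" for X Y
  proof (rule eq_matI, goal_cases)
    case (1 r c)
    then have rc: "r < m' * k" "c < m' * k" by (auto simp: act_left_def)
    have "?B (X + Y) r c = ?B X r c + ?B Y r c"
      using X Y rc pos by (intro eq_matI) (auto simp: pair_index_less)
    then have "E (?B (X + Y) r c) = E (?B X r c) + E (?B Y r c)"
      using E by (simp add: linear_mat_map_def)
    then show ?case using rc div carrier_matD[OF carr] by (simp add: act_left_def)
  qed (auto simp: act_left_def)
  have smult: "act_left m m' k E (z \<cdot>\<^sub>m X) = z \<cdot>\<^sub>m act_left m m' k E X"
    if X: "X \<in> carrier_mat (m * k) (m * k)" for z X
  proof (rule eq_matI, goal_cases)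
    case (1 r c)
    then have rc: "r < m' * k" "c < m' * k" by (auto simp: act_left_def)
    have "?B (z \<cdot>\<^sub>m X) r c = z \<cdot>\<^sub>m ?B X r c"
      using X rc pos by (intro eq_matI) (auto simp: pair_index_less)
    then have "E (?B (z \<cdot>\<^sub>m X) r c) = z \<cdot>\<^sub>m E (?B X r c)"
      using E by (simp add: linear_mat_map_def)
    then show ?case using rc div carrier_matD[OF carr] by (simp add: act_left_def)
  qed (auto simp: act_left_def)
  from add smult show ?thesis by (simp add: linear_mat_map_def)
qed

lemma linear_mat_map_act_right:
  assumes E: "linear_mat_map m m' E"
  shows "linear_mat_map (k * m) (k * m') (act_right k m m' E)"
proof -
  let ?B = "\<lambda>X r c. mat m m (\<lambda>(i, j). X $$ ((r div m') * m + i, (c div m') * m + j)) :: complex mat"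
  have carr: "E (?B X r c) \<in> carrier_mat m' m'" for X r c
    using linear_mat_map_carrier[OF E] by auto
  have div: "r div m' < k" if "r < k * m'" for r
    using that by (rule less_mult_imp_div_less)
  have pos: "0 < m'" if "r < k * m'" for r using that by (cases m') auto
  have add: "act_right k m m' E (X + Y) = act_right k m m' E X + act_right k m m' E Y"
    if X: "X \<in> carrier_mat (k * m) (k * m)" and Y: "Y \<in> carrier_mat (k * m) (k * m)" for X Y
  proof (rule eq_matI, goal_cases)
    case (1 r c)
    then have rc: "r < k * m'" "c < k * m'" by (auto simp: act_right_def)
    have "?B (X + Y) r c = ?B X r c + ?B Y r c"
      using X Y rc div by (intro eq_matI) (auto simp: pair_index_less)
    then have "E (?B (X + Y) r c) = E (?B X r c) + E (?B Y r c)"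
      using E by (simp add: linear_mat_map_def)
    then show ?case using rc pos carrier_matD[OF carr] by (simp add: act_right_def)
  qed (auto simp: act_right_def)
  have smult: "act_right k m m' E (z \<cdot>\<^sub>m X) = z \<cdot>\<^sub>m act_right k m m' E X"
    if X: "X \<in> carrier_mat (k * m) (k * m)" for z X
  proof (rule eq_matI, goal_cases)
    case (1 r c)
    then have rc: "r < k * m'" "c < k * m'" by (auto simp: act_right_def)
    have "?B (z \<cdot>\<^sub>m X) r c = z \<cdot>\<^sub>m ?B X r c"
      using X rc div by (intro eq_matI) (auto simp: pair_index_less)
    then have "E (?B (z \<cdot>\<^sub>m X) r c) = z \<cdot>\<^sub>m E (?B X r c)"
      using E by (simp add: linear_mat_map_def)
    then show ?case using rc pos carrier_matD[OF carr] by (simp add: act_right_def)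
  qed (auto simp: act_right_def)
  from add smult show ?thesis by (simp add: linear_mat_map_def)
qed

text \<open>The common form of a round of either party: \<open>A i\<close> is the one-sided action
  for outcome \<open>i\<close>, and \<open>L i\<close> is the rest of the protocol.\<close>

lemma linear_mat_map_mat_sum:
  assumes A: "\<And>i. i < n \<Longrightarrow> linear_mat_map m (m' i) (A i)"
    and L: "\<And>i. i < n \<Longrightarrow> linear_mat_map (m' i) d (L i)"
    and eq: "\<And>X. X \<in> carrier_mat m m \<Longrightarrow> \<Lambda> X = mat_sum d n (\<lambda>i. L i (A i X))"
  shows "linear_mat_map m d \<Lambda>"
proof -
  have carr: "L i (A i X) \<in> carrier_mat d d" if "i < n" "X \<in> carrier_mat m m" for i X
    using A[OF that(1)] L[OF that(1)] that(2) by (auto simp: linear_mat_map_def)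
  have add: "L i (A i (X + Y)) = L i (A i X) + L i (A i Y)"
    if "i < n" "X \<in> carrier_mat m m" "Y \<in> carrier_mat m m" for i X Y
    using A[OF that(1)] L[OF that(1)] that(2,3) by (auto simp: linear_mat_map_def)
  have smult: "L i (A i (z \<cdot>\<^sub>m X)) = z \<cdot>\<^sub>m L i (A i X)"
    if "i < n" "X \<in> carrier_mat m m" for i z X
    using A[OF that(1)] L[OF that(1)] that(2) by (auto simp: linear_mat_map_def)
  show ?thesis unfolding linear_mat_map_def
  proof (intro conjI ballI allI)
    fix X :: "complex mat" assume X: "X \<in> carrier_mat m m"
    then show "\<Lambda> X \<in> carrier_mat d d" by (simp add: eq mat_sum_def)
    show "\<Lambda> (z \<cdot>\<^sub>m X) = z \<cdot>\<^sub>m \<Lambda> X" for z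
      using X carrier_matD[OF carr] by (intro eq_matI) (auto simp: eq mat_sum_def smult sum_distrib_left)
    fix Y :: "complex mat" assume Y: "Y \<in> carrier_mat m m"
    show "\<Lambda> (X + Y) = \<Lambda> X + \<Lambda> Y"
      using X Y carrier_matD[OF carr] by (intro eq_matI) (auto simp: eq mat_sum_def add sum.distrib)
  qed
qed

text \<open>Needed to evaluate an LOCC map on the difference of a multiple of the identity and a
  state.\<close>

lemma locc_linear:
  assumes "locc dA dB a b \<Lambda>"
  shows "linear_mat_map (a * b) (dA * dB) \<Lambda>"
  using assms
proof induction
  case (stop \<Lambda>)
  then show ?case by (simp add: linear_mat_map_def)
next
  case (alice a n a' E b L \<Lambda>)
  show ?case
    by (rule linear_mat_map_mat_sum[of n "a * b" "\<lambda>i. a' i * b" "\<lambda>i. act_left a (a' i) b (E i)" _ L])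
      (use alice in \<open>auto simp: instrument_def completely_positive_def intro: linear_mat_map_act_left\<close>)
next
  case (bob b n b' E a L \<Lambda>)
  show ?case
    by (rule linear_mat_map_mat_sum[of n "a * b" "\<lambda>i. a * b' i" "\<lambda>i. act_right a b (b' i) (E i)" _ L])
      (use bob in \<open>auto simp: instrument_def completely_positive_def intro: linear_mat_map_act_right\<close>)
qed

section \<open>Local unitaries\<close>

lemma mat_adjoint_dim [simp]: "dim_row (mat_adjoint A) = dim_col A" "dim_col (mat_adjoint A) = dim_row A"
  by (simp_all add: mat_adjoint_def)

lemma mat_adjoint_carrier [simp]: "A \<in> carrier_mat n m \<Longrightarrow> mat_adjoint A \<in> carrier_mat m n"
  by (intro carrier_matI) auto

lemma mat_adjoint_index [simp]:
  fixes A :: "complex mat"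
  shows "i < dim_col A \<Longrightarrow> j < dim_row A \<Longrightarrow> mat_adjoint A $$ (i, j) = cnj (A $$ (j, i))"
  by (simp add: mat_adjoint_def mat_of_rows_index)

lemma mat_mult_sum:
  fixes A B :: "complex mat"
  assumes "A \<in> carrier_mat n m" "B \<in> carrier_mat m l" "r < n" "c < l"
  shows "(A * B) $$ (r, c) = (\<Sum>k<m. A $$ (r, k) * B $$ (k, c))"
  using assms by (auto simp: scalar_prod_def atLeast0LessThan intro!: sum.cong)

lemma mat_vec_sum:
  fixes A :: "complex mat"
  assumes "A \<in> carrier_mat n m" "u \<in> carrier_vec m" "r < n"
  shows "(A *\<^sub>v u) $ r = (\<Sum>k<m. A $$ (r, k) * u $ k)"
  using assms by (auto simp: scalar_prod_def atLeast0LessThan intro!: sum.cong)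

lemma cscalar_sum:
  fixes u z :: "complex vec"
  assumes "z \<in> carrier_vec n"
  shows "u \<bullet>c z = (\<Sum>k<n. u $ k * cnj (z $ k))"
  using assms by (auto simp: scalar_prod_def atLeast0LessThan intro!: sum.cong)

lemma cscalar_mat_adjoint:
  fixes z :: "complex vec"
  assumes A: "A \<in> carrier_mat n n" and u: "u \<in> carrier_vec n" and z: "z \<in> carrier_vec n"
  shows "(A *\<^sub>v u) \<bullet>c z = u \<bullet>c (mat_adjoint A *\<^sub>v z)"
proof -
  have "(A *\<^sub>v u) \<bullet>c z = (\<Sum>k<n. \<Sum>j<n. A $$ (k, j) * u $ j * cnj (z $ k))"
    unfolding cscalar_sum[OF z] by (intro sum.cong refl) (simp add: mat_vec_sum[OF A u] sum_distrib_right)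
  also have "\<dots> = (\<Sum>j<n. \<Sum>k<n. A $$ (k, j) * u $ j * cnj (z $ k))"
    by (rule sum.swap)
  also have "\<dots> = u \<bullet>c (mat_adjoint A *\<^sub>v z)"
    using A by (subst cscalar_sum[OF mult_mat_vec_carrier[OF mat_adjoint_carrier[OF A] z]])
      (auto simp: mat_vec_sum[OF mat_adjoint_carrier[OF A] z] sum_distrib_left mult_ac
        simp del: index_mult_mat_vec intro!: sum.cong)
  finally show ?thesis .
qed

text \<open>Serves twice: it shows that congruence preserves positivity, and it moves local
  unitaries from the state to the vector against which the overlap is taken.\<close>

lemma congruence_form:
  fixes u :: "complex vec"
  assumes W: "W \<in> carrier_mat n n" and X: "X \<in> carrier_mat n n" and u: "u \<in> carrier_vec n"
  shows "((W * X * mat_adjoint W) *\<^sub>v u) \<bullet>c u =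
    (X *\<^sub>v (mat_adjoint W *\<^sub>v u)) \<bullet>c (mat_adjoint W *\<^sub>v u)"
proof -
  note W' = mat_adjoint_carrier[OF W]
  note W'u = mult_mat_vec_carrier[OF W' u]
  have "(W * X * mat_adjoint W) *\<^sub>v u = W *\<^sub>v (X *\<^sub>v (mat_adjoint W *\<^sub>v u))"
    by (simp only: assoc_mult_mat_vec[OF mult_carrier_mat[OF W X] W' u] assoc_mult_mat_vec[OF W X W'u])
  then show ?thesis
    by (simp only: cscalar_mat_adjoint[OF W mult_mat_vec_carrier[OF X W'u] u])
qed

lemma psd_congruence:
  assumes W: "W \<in> carrier_mat n n" and X: "psd n X"
  shows "psd n (W * X * mat_adjoint W)"
  using X W mult_mat_vec_carrier[OF mat_adjoint_carrier[OF W]]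
  by (auto simp: psd_def congruence_form simp del: mult_mat_vec_carrier intro!: mult_carrier_mat[of _ n n])

section \<open>Algebra of tensor products\<close>

lemma tensor_mat_carrier [simp]:
  "A \<in> carrier_mat a c \<Longrightarrow> B \<in> carrier_mat b d \<Longrightarrow> tensor_mat A B \<in> carrier_mat (a * b) (c * d)"
  by (auto simp: tensor_mat_def)

lemma tensor_mat_index:
  assumes "A \<in> carrier_mat a c" "B \<in> carrier_mat b d" "i < a" "q < b" "j < c" "p < d"
  shows "tensor_mat A B $$ (i * b + q, j * d + p) = A $$ (i, j) * B $$ (q, p)"
  using assms by (auto simp: tensor_mat_def pair_index_less)

text \<open>Division with remainder writes every row and column index as a composite one. Matrices
  can thus be compared at indices where tensor products factor, without \<open>div\<close> and
  \<open>mod\<close>.\<close>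

lemma eq_block_matI:
  assumes X: "X \<in> carrier_mat (a * b) (c * d)" and Y: "Y \<in> carrier_mat (a * b) (c * d)"
    and eq: "\<And>i q j p. i < a \<Longrightarrow> q < b \<Longrightarrow> j < c \<Longrightarrow> p < d \<Longrightarrow>
      X $$ (i * b + q, j * d + p) = Y $$ (i * b + q, j * d + p)"
  shows "X = Y"
proof (rule eq_matI)
  fix r s assume "r < dim_row Y" "s < dim_col Y"
  then have r: "r < a * b" and s: "s < c * d" using Y by auto
  then have "0 < b" "0 < d" by (auto intro: gr0I)
  then show "X $$ (r, s) = Y $$ (r, s)"
    using eq[of "r div b" "r mod b" "s div d" "s mod d"] r s by (simp add: less_mult_imp_div_less)
qed (use X Y in auto)

lemma tensor_mat_mult:
  assumes A: "A \<in> carrier_mat a a" and B: "B \<in> carrier_mat b b"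
    and C: "C \<in> carrier_mat a a" and D: "D \<in> carrier_mat b b"
  shows "tensor_mat A B * tensor_mat C D = tensor_mat (A * C) (B * D)"
proof (rule eq_block_matI[where a = a and b = b and c = a and d = b])
  fix i q j p assume *: "i < a" "q < b" "j < a" "p < b"
  have "(tensor_mat A B * tensor_mat C D) $$ (i * b + q, j * b + p)
     = (\<Sum>k<a. \<Sum>l<b. (A $$ (i, k) * B $$ (q, l)) * (C $$ (k, j) * D $$ (l, p)))"
    using * by (subst mat_mult_sum[OF tensor_mat_carrier[OF A B] tensor_mat_carrier[OF C D]])
      (auto simp: pair_index_less sum_mult_lessThan tensor_mat_index[OF A B] tensor_mat_index[OF C D])
  also have "\<dots> = (A * C) $$ (i, j) * (B * D) $$ (q, p)"
    using * by (simp add: mat_mult_sum[OF A C] mat_mult_sum[OF B D] sum_product mult_ac del: index_mult_mat)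
  finally show "(tensor_mat A B * tensor_mat C D) $$ (i * b + q, j * b + p)
     = tensor_mat (A * C) (B * D) $$ (i * b + q, j * b + p)"
    using * by (subst tensor_mat_index[of _ a a _ b b]) (use A B C D in auto)
qed (use A B C D in \<open>auto intro!: mult_carrier_mat[of _ _ "a * b"]\<close>)

lemma mat_adjoint_tensor:
  assumes A: "A \<in> carrier_mat a a" and B: "B \<in> carrier_mat b b"
  shows "mat_adjoint (tensor_mat A B) = tensor_mat (mat_adjoint A) (mat_adjoint B)"
proof (rule eq_block_matI[where a = a and b = b and c = a and d = b])
  note C = tensor_mat_carrier[OF A B]
  fix i q j p assume *: "i < a" "q < b" "j < a" "p < b"
  then show "mat_adjoint (tensor_mat A B) $$ (i * b + q, j * b + p)
     = tensor_mat (mat_adjoint A) (mat_adjoint B) $$ (i * b + q, j * b + p)"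
    using A B carrier_matD[OF C]
    by (simp add: tensor_mat_index[of _ a a _ b b] pair_index_less)
qed (use A B in auto)

lemma tensor_mat_vec:
  assumes A: "A \<in> carrier_mat a a" and B: "B \<in> carrier_mat b b"
    and x: "x \<in> carrier_vec a" and y: "y \<in> carrier_vec b"
  shows "tensor_mat A B *\<^sub>v tensor_vec x y = tensor_vec (A *\<^sub>v x) (B *\<^sub>v y)"
proof (rule eq_vecI)
  note Ax = mult_mat_vec_carrier[OF A x] and By = mult_mat_vec_carrier[OF B y]
  fix r assume "r < dim_vec (tensor_vec (A *\<^sub>v x) (B *\<^sub>v y))"
  then have r: "r < a * b" using carrier_vecD[OF tensor_vec_carrier[OF Ax By]] by simp
  then have "0 < b" by (auto intro: gr0I)
  with r have *: "r div b < a" "r mod b < b" and r_eq: "r = r div b * b + r mod b"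
    by (auto simp: less_mult_imp_div_less)
  have "tensor_mat A B $$ (r, k * b + l) = A $$ (r div b, k) * B $$ (r mod b, l)"
    if "k < a" "l < b" for k l
    using tensor_mat_index[OF A B * that] r_eq by simp
  then have "(tensor_mat A B *\<^sub>v tensor_vec x y) $ r = (\<Sum>k<a. \<Sum>l<b.
      A $$ (r div b, k) * B $$ (r mod b, l) * (x $ k * y $ l))"
    by (subst mat_vec_sum[OF tensor_mat_carrier[OF A B] tensor_vec_carrier[OF x y] r])
      (simp add: sum_mult_lessThan tensor_vec_index[OF x y])
  also have "\<dots> = (A *\<^sub>v x) $ (r div b) * (B *\<^sub>v y) $ (r mod b)"
    using * by (simp add: mat_vec_sum[OF A x] mat_vec_sum[OF B y] sum_product mult_ac del: index_mult_mat_vec)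
  also have "\<dots> = tensor_vec (A *\<^sub>v x) (B *\<^sub>v y) $ r"
    by (subst (3) r_eq, subst tensor_vec_index[OF Ax By *]) simp
  finally show "(tensor_mat A B *\<^sub>v tensor_vec x y) $ r = tensor_vec (A *\<^sub>v x) (B *\<^sub>v y) $ r" .
qed (use assms in \<open>auto simp: tensor_mat_def tensor_vec_def\<close>)

section \<open>Conjugation by local unitaries as an LOCC protocol\<close>

lemma sandwich_sum:
  fixes A X B :: "complex mat"
  assumes A: "A \<in> carrier_mat n n" and X: "X \<in> carrier_mat n n" and B: "B \<in> carrier_mat n n"
    and rc: "r < n" "c < n"
  shows "(A * X * B) $$ (r, c) = (\<Sum>s<n. \<Sum>t<n. A $$ (r, t) * X $$ (t, s) * B $$ (s, c))"
  unfolding mat_mult_sum[OF mult_carrier_mat[OF A X] B rc]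
  by (intro sum.cong refl) (simp add: mat_mult_sum[OF A X rc(1)] sum_distrib_right del: index_mult_mat)

text \<open>Conjugating each block by \<open>U\<close> is conjugating the whole matrix by
  \<open>U \<otimes> 1\<close>. This gives complete positivity for every ancilla dimension and
  identifies the effect of Alice's round.\<close>

lemma act_left_congruence:
  assumes U: "U \<in> carrier_mat m m" and X: "X \<in> carrier_mat (m * k) (m * k)"
  shows "act_left m m k (\<lambda>Y. U * Y * mat_adjoint U) X =
    tensor_mat U (1\<^sub>m k) * X * mat_adjoint (tensor_mat U (1\<^sub>m k))" (is "?L = ?W * X * mat_adjoint ?W")
proof (rule eq_block_matI[where a = m and b = k and c = m and d = k])
  have W: "?W \<in> carrier_mat (m * k) (m * k)" using U by auto
  fix i q j p assume *: "i < m" "q < k" "j < m" "p < k"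
  have "?L $$ (i * k + q, j * k + p)
    = (\<Sum>s<m. \<Sum>t<m. U $$ (i, t) * X $$ (t * k + q, s * k + p) * cnj (U $$ (j, s)))"
    using * U by (simp add: act_left_def pair_index_less sandwich_sum[of _ m] del: index_mult_mat)
  \<comment> \<open>The inserted sums carry Kronecker deltas, which are the entries of the identity
    factor in \<open>?W\<close> and its adjoint.\<close>
  also have "\<dots> = (\<Sum>s<m. \<Sum>t<m. \<Sum>p'<k. \<Sum>q'<k. (if q' = q then if p' = p then
      U $$ (i, t) * X $$ (t * k + q', s * k + p') * cnj (U $$ (j, s)) else 0 else 0))"
    using * by simp
  also have "\<dots> = (\<Sum>s<m. \<Sum>p'<k. \<Sum>t<m. \<Sum>q'<k. (if q' = q then if p' = p then
      U $$ (i, t) * X $$ (t * k + q', s * k + p') * cnj (U $$ (j, s)) else 0 else 0))"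
    by (intro sum.cong refl sum.swap)
  also have "\<dots> = (?W * X * mat_adjoint ?W) $$ (i * k + q, j * k + p)"
    using * carrier_matD[OF W]
    by (subst sandwich_sum[OF W X mat_adjoint_carrier[OF W]], simp add: pair_index_less,
        simp add: pair_index_less, unfold sum_mult_lessThan, intro sum.cong refl)
      (auto simp: pair_index_less tensor_mat_index[OF U one_carrier_mat])
  finally show "?L $$ (i * k + q, j * k + p) = (?W * X * mat_adjoint ?W) $$ (i * k + q, j * k + p)" .
qed (use U X in \<open>auto intro!: mult_carrier_mat[of _ _ "m * k"]\<close>)

lemma act_right_congruence:
  assumes V: "V \<in> carrier_mat m m" and X: "X \<in> carrier_mat (k * m) (k * m)"
  shows "act_right k m m (\<lambda>Y. V * Y * mat_adjoint V) X =
    tensor_mat (1\<^sub>m k) V * X * mat_adjoint (tensor_mat (1\<^sub>m k) V)" (is "?L = ?W * X * mat_adjoint ?W")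
proof (rule eq_block_matI[where a = k and b = m and c = k and d = m])
  have W: "?W \<in> carrier_mat (k * m) (k * m)" using V by auto
  fix i q j p assume *: "i < k" "q < m" "j < k" "p < m"
  have "?L $$ (i * m + q, j * m + p)
    = (\<Sum>s<m. \<Sum>t<m. V $$ (q, t) * X $$ (i * m + t, j * m + s) * cnj (V $$ (p, s)))"
    using * V by (simp add: act_right_def pair_index_less sandwich_sum[of _ m] del: index_mult_mat)
  \<comment> \<open>The identity is the first factor here, so its indices \<open>j'\<close> and
    \<open>i'\<close> have to end up outside \<open>s\<close> and \<open>t\<close> respectively,
    which takes three exchanges.\<close>
  also have "\<dots> = (\<Sum>s<m. \<Sum>t<m. \<Sum>j'<k. \<Sum>i'<k. (if i' = i then if j' = j then
      V $$ (q, t) * X $$ (i' * m + t, j' * m + s) * cnj (V $$ (p, s)) else 0 else 0))"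
    using * by simp
  also have "\<dots> = (\<Sum>s<m. \<Sum>j'<k. \<Sum>t<m. \<Sum>i'<k. (if i' = i then if j' = j then
      V $$ (q, t) * X $$ (i' * m + t, j' * m + s) * cnj (V $$ (p, s)) else 0 else 0))"
    by (intro sum.cong refl sum.swap)
  also have "\<dots> = (\<Sum>j'<k. \<Sum>s<m. \<Sum>t<m. \<Sum>i'<k. (if i' = i then if j' = j then
      V $$ (q, t) * X $$ (i' * m + t, j' * m + s) * cnj (V $$ (p, s)) else 0 else 0))"
    by (rule sum.swap)
  also have "\<dots> = (\<Sum>j'<k. \<Sum>s<m. \<Sum>i'<k. \<Sum>t<m. (if i' = i then if j' = j then
      V $$ (q, t) * X $$ (i' * m + t, j' * m + s) * cnj (V $$ (p, s)) else 0 else 0))"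
    by (intro sum.cong refl sum.swap)
  also have "\<dots> = (?W * X * mat_adjoint ?W) $$ (i * m + q, j * m + p)"
    using * carrier_matD[OF W]
    by (subst sandwich_sum[OF W X mat_adjoint_carrier[OF W]], simp add: pair_index_less,
        simp add: pair_index_less, unfold sum_mult_lessThan, intro sum.cong refl)
      (auto simp: pair_index_less tensor_mat_index[OF one_carrier_mat V])
  finally show "?L $$ (i * m + q, j * m + p) = (?W * X * mat_adjoint ?W) $$ (i * m + q, j * m + p)" .
qed (use V X in \<open>auto intro!: mult_carrier_mat[of _ _ "k * m"]\<close>)

lemma mat_trace_mult_commute:
  assumes A: "A \<in> carrier_mat n n" and B: "B \<in> carrier_mat n n"
  shows "mat_trace (A * B) = mat_trace (B * A)"
proof -
  have "mat_trace (A * B) = (\<Sum>i<n. \<Sum>k<n. A $$ (i, k) * B $$ (k, i))"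
    using A by (simp add: mat_trace_def mat_mult_sum[OF A B] del: index_mult_mat(1))
  also have "\<dots> = (\<Sum>k<n. \<Sum>i<n. A $$ (i, k) * B $$ (k, i))"
    by (rule sum.swap)
  also have "\<dots> = mat_trace (B * A)"
    using B by (simp add: mat_trace_def mat_mult_sum[OF B A] mult.commute del: index_mult_mat(1))
  finally show ?thesis .
qed

text \<open>A measurement with a single outcome. Complete positivity is congruence by
  \<open>U \<otimes> 1\<close> for every ancilla, and the trace is preserved by cyclicity and
  \<open>mat_adjoint U * U = 1\<^sub>m m\<close>.\<close>

lemma instrument_unitary:
  assumes "unitary_mat m U" and "0 < m"
  shows "instrument m 1 (\<lambda>_. m) (\<lambda>_ X. U * X * mat_adjoint U)"
proof -
  have U: "U \<in> carrier_mat m m" and UU: "mat_adjoint U * U = 1\<^sub>m m"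
    using assms by (auto simp: unitary_mat_def)
  note U' = mat_adjoint_carrier[OF U]
  have "linear_mat_map m m (\<lambda>X. U * X * mat_adjoint U)"
    using U U' mult_carrier_mat[OF U]
    by (simp add: linear_mat_map_def mult_carrier_mat[OF mult_carrier_mat[OF U] U']
        mult_add_distrib_mat[OF U] add_mult_distrib_mat[OF mult_carrier_mat[OF U] mult_carrier_mat[OF U] U']
        mult_smult_distrib[OF U] mult_smult_assoc_mat[OF mult_carrier_mat[OF U] U'])
  moreover have "psd (m * k) (act_left m m k (\<lambda>X. U * X * mat_adjoint U) X)" if "psd (m * k) X" for k X
    using that U by (subst act_left_congruence) (auto intro!: psd_congruence simp: psd_def[of _ X])
  moreover have "mat_trace (U * X * mat_adjoint U) = mat_trace X" if X: "X \<in> carrier_mat m m" for X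
  proof -
    have "mat_trace (U * X * mat_adjoint U) = mat_trace (mat_adjoint U * (U * X))"
      by (rule mat_trace_mult_commute[OF mult_carrier_mat[OF U X] U'])
    also have "mat_adjoint U * (U * X) = X"
      using X U by (simp add: UU flip: assoc_mult_mat[OF U' U X])
    finally show ?thesis .
  qed
  ultimately show ?thesis using \<open>0 < m\<close> by (simp add: instrument_def completely_positive_def)
qed

lemma mat_adjoint_one [simp]: "mat_adjoint (1\<^sub>m n) = (1\<^sub>m n :: complex mat)"
  by (intro eq_matI) auto

lemma mat_sum_one: "F 0 \<in> carrier_mat d d \<Longrightarrow> mat_sum d 1 F = F 0"
  by (intro eq_matI) (auto simp: mat_sum_def)

lemma locc_local_unitaries:
  assumes "0 < dA" "0 < dB" and UU: "unitary_mat dA U" and VV: "unitary_mat dB V"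
  shows "locc dA dB dA dB (\<lambda>X. tensor_mat U V * X * tensor_mat (mat_adjoint U) (mat_adjoint V))"
proof -
  let ?d = "dA * dB"
  have U: "U \<in> carrier_mat dA dA" and V: "V \<in> carrier_mat dB dB"
    using UU VV by (auto simp: unitary_mat_def)
  let ?A = "tensor_mat U (1\<^sub>m dB)" and ?B = "tensor_mat (1\<^sub>m dA) V"
  have A: "?A \<in> carrier_mat ?d ?d" and B: "?B \<in> carrier_mat ?d ?d" using U V by auto
  note A' = mat_adjoint_carrier[OF A] and B' = mat_adjoint_carrier[OF B]
  \<comment> \<open>Bob's round comes first in the construction because it is the protocol that
    remains after Alice's.\<close>
  have bob_locc: "locc dA dB dA dB (\<lambda>X. ?B * X * mat_adjoint ?B)"
  proof (rule locc.bob[OF instrument_unitary[OF VV \<open>0 < dB\<close>], where L = "\<lambda>_ X. X"])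
    show "locc dA dB dA dB (\<lambda>X. X)" by (rule locc.stop) simp
    show "?B * X * mat_adjoint ?B
      = mat_sum ?d 1 (\<lambda>i. act_right dA dB dB (\<lambda>X. V * X * mat_adjoint V) X)"
      if X: "X \<in> carrier_mat ?d ?d" for X
      using mult_carrier_mat[OF mult_carrier_mat[OF B X] B']
      by (simp only: act_right_congruence[OF V X] mat_sum_one)
  qed
  show ?thesis
  proof (rule locc.alice[OF instrument_unitary[OF UU \<open>0 < dA\<close>], where L = "\<lambda>_ X. ?B * X * mat_adjoint ?B"])
    fix X :: "complex mat" assume X: "X \<in> carrier_mat ?d ?d"
    note AX = mult_carrier_mat[OF A X]
    \<comment> \<open>Alice acts first, so her factor stands next to \<open>X\<close>.\<close>
    have "tensor_mat U V = ?B * ?A"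
      using U V by (simp add: tensor_mat_mult[where a = dA and b = dB])
    moreover have "tensor_mat (mat_adjoint U) (mat_adjoint V) = mat_adjoint ?A * mat_adjoint ?B"
      using U V by (simp add: tensor_mat_mult[where a = dA and b = dB] mat_adjoint_tensor[where a = dA and b = dB])
    moreover have "?B * ?A * X * (mat_adjoint ?A * mat_adjoint ?B)
      = ?B * (?A * X * mat_adjoint ?A) * mat_adjoint ?B"
      using A B X A' B' AX
      by (smt (verit) assoc_mult_mat mult_carrier_mat)
    moreover have "?B * (?A * X * mat_adjoint ?A) * mat_adjoint ?B \<in> carrier_mat ?d ?d"
      by (rule mult_carrier_mat[OF mult_carrier_mat[OF B mult_carrier_mat[OF AX A']] B'])
    ultimately show "tensor_mat U V * X * tensor_mat (mat_adjoint U) (mat_adjoint V)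
      = mat_sum ?d 1 (\<lambda>i. ?B * act_left dA dA dB (\<lambda>X. U * X * mat_adjoint U) X * mat_adjoint ?B)"
      by (simp only: act_left_congruence[OF U X] mat_sum_one)
  qed (rule bob_locc)
qed

text \<open>
  The unitary is the generalised Householder reflection \<open>1 - w w\<^sup>\<dagger> / (w\<^sup>\<dagger> x)\<close> with \<open>w = x - v\<close>, which
  maps \<open>x\<close> to \<open>v\<close>. It is unitary because \<open>w\<^sup>\<dagger> w = w\<^sup>\<dagger> x + cnj (w\<^sup>\<dagger> x)\<close>. If \<open>w\<^sup>\<dagger> x = 0\<close>, then \<open>w = 0\<close>, and
  the junk value \<open>inverse 0 = 0\<close> makes the formula the identity, as it should be.
\<close>

lemma unitary_transitive:
  assumes x: "unit_vector n x" and v: "unit_vector n v"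
  obtains U where "unitary_mat n U" "mat_adjoint U *\<^sub>v v = x"
proof -
  have xc: "x \<in> carrier_vec n" and vc: "v \<in> carrier_vec n"
    using x v by (auto simp: unit_vector_def)
  have xx: "(\<Sum>i<n. x $ i * cnj (x $ i)) = 1" and vv: "(\<Sum>i<n. v $ i * cnj (v $ i)) = 1"
    using x v by (auto simp: unit_vector_def cscalar_sum)
  define w where "w = (\<lambda>i. x $ i - v $ i)"
  define \<alpha> where "\<alpha> = (\<Sum>i<n. cnj (w i) * x $ i)"
  define c where "c = inverse \<alpha>"
  \<comment> \<open>Equality of the norms of \<open>x\<close> and \<open>v\<close> enters here: the
    two sides differ by the difference of the squared norms.\<close>
  have N: "(\<Sum>i<n. w i * cnj (w i)) = \<alpha> + cnj \<alpha>"
  proof -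
    have "\<alpha> + cnj \<alpha> - (\<Sum>i<n. w i * cnj (w i))
      = (\<Sum>i<n. x $ i * cnj (x $ i)) - (\<Sum>i<n. v $ i * cnj (v $ i))"
      unfolding \<alpha>_def w_def cnj_sum sum.distrib[symmetric] sum_subtractf[symmetric]
      by (intro sum.cong refl) (simp add: algebra_simps)
    then show ?thesis by (simp add: xx vv)
  qed
  \<comment> \<open>This makes the term quadratic in \<open>c\<close> cancel the two linear ones in
    \<open>U * mat_adjoint U\<close>.\<close>
  have cN: "c * cnj c * (\<alpha> + cnj \<alpha>) = c + cnj c"
    by (cases "\<alpha> = 0") (auto simp: c_def field_simps)
  define U where "U = mat n n (\<lambda>(i, j). (if i = j then 1 else 0) - w i * cnj (w j) * c)"
  have U: "U \<in> carrier_mat n n" by (simp add: U_def)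
  note U' = mat_adjoint_carrier[OF U]
  have UU': "U * mat_adjoint U = 1\<^sub>m n"
  proof (rule eq_matI)
    fix i j assume "i < dim_row (1\<^sub>m n :: complex mat)" "j < dim_col (1\<^sub>m n :: complex mat)"
    then have ij: "i < n" "j < n" by auto
    have "(U * mat_adjoint U) $$ (i, j) = (\<Sum>k<n. ((if i = k then 1 else 0) - w i * cnj (w k) * c)
        * ((if j = k then 1 else 0) - w k * cnj (w j) * cnj c))"
      using ij U by (subst mat_mult_sum[OF U U' ij])
        (auto simp: U_def mult_ac intro!: sum.cong)
    also have "\<dots> = (\<Sum>k<n. (if k = i then (if i = j then 1 else 0) - w i * cnj (w j) * cnj c else 0)
        - (if k = j then w i * cnj (w j) * c else 0)
        + (w k * cnj (w k)) * (w i * cnj (w j) * (c * cnj c)))"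
      by (intro sum.cong refl) (auto simp: algebra_simps)
    also have "\<dots> = (if i = j then 1 else 0) - w i * cnj (w j) * cnj c - w i * cnj (w j) * c
        + (\<alpha> + cnj \<alpha>) * (w i * cnj (w j) * (c * cnj c))"
      using ij by (simp add: sum.distrib sum_subtractf flip: sum_distrib_right N)
    also have "(\<alpha> + cnj \<alpha>) * (w i * cnj (w j) * (c * cnj c)) = w i * cnj (w j) * (c + cnj c)"
      by (simp flip: cN)
    finally show "(U * mat_adjoint U) $$ (i, j) = 1\<^sub>m n $$ (i, j)"
      using ij by (simp add: algebra_simps)
  qed (use U in auto)
  have U'U: "mat_adjoint U * U = 1\<^sub>m n"
    by (rule mat_mult_left_right_inverse[OF U U' UU'])
  have Ux: "U *\<^sub>v x = v"
  proof (rule eq_vecI)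
    fix i assume "i < dim_vec v"
    then have i: "i < n" using vc by simp
    have w0: "w i = 0" if "\<alpha> = 0"
    proof -
      have "of_real (\<Sum>k<n. (norm (w k))\<^sup>2) = (0 :: complex)"
        using N that by (simp add: complex_norm_square del: of_real_power)
      then have "(\<Sum>k<n. (norm (w k))\<^sup>2) = 0" by (simp only: of_real_eq_0_iff)
      then show ?thesis using i by (subst (asm) sum_nonneg_eq_0_iff) auto
    qed
    have "(U *\<^sub>v x) $ i = (\<Sum>k<n. (if k = i then x $ i else 0) - w i * c * (cnj (w k) * x $ k))"
      using i by (subst mat_vec_sum[OF U xc i]) (auto simp: U_def algebra_simps intro!: sum.cong)
    also have "\<dots> = x $ i - w i * c * \<alpha>"
      using i by (simp add: sum_subtractf \<alpha>_def sum_distrib_left)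
    also have "\<dots> = v $ i"
      using w0 by (cases "\<alpha> = 0") (auto simp: c_def w_def mult.assoc)
    finally show "(U *\<^sub>v x) $ i = v $ i" .
  qed (use U vc in auto)
  have "mat_adjoint U *\<^sub>v v = x"
    using U'U xc by (simp flip: Ux assoc_mult_mat_vec[OF U' U xc])
  then show thesis using that U UU' U'U by (auto simp: unitary_mat_def)
qed

section \<open>Maximisation over product vectors\<close>

text \<open>A compact box that contains every coordinate of a unit vector.\<close>

definition unit_square :: "complex set" where
  "unit_square = {z. \<bar>Re z\<bar> \<le> 1 \<and> \<bar>Im z\<bar> \<le> 1}"

lemma compact_unit_square: "compact unit_square"
proof -
  have "compact ((\<lambda>(s, t). of_real s + \<i> * of_real t) ` ({-1..1} \<times> {-1..1}) :: complex set)"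
    unfolding case_prod_unfold
    by (intro compact_continuous_image compact_Times compact_Icc continuous_intros)
  also have "(\<lambda>(s, t). of_real s + \<i> * of_real t) ` ({-1..1} \<times> {-1..1}) = unit_square"
  proof
    show "unit_square \<subseteq> (\<lambda>(s, t). of_real s + \<i> * of_real t) ` ({-1..1} \<times> {-1..1})"
    proof
      fix z assume "z \<in> unit_square"
      then show "z \<in> (\<lambda>(s, t). of_real s + \<i> * of_real t) ` ({-1..1} \<times> {-1..1})"
        by (intro image_eqI[of _ _ "(Re z, Im z)"]) (auto simp: unit_square_def complex_eq_iff)
    qed
  qed (auto simp: unit_square_def)
  finally show ?thesis .
qed

text \<open>Unit vectors as functions on all of \<open>nat\<close>, to which the product topology
  applies. Coordinates from \<open>n\<close> on range freely over the box and disappear under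
  \<open>vec n\<close>.\<close>

definition unit_functions :: "nat \<Rightarrow> (nat \<Rightarrow> complex) set" where
  "unit_functions n = {f. (\<forall>i. f i \<in> unit_square) \<and> (\<Sum>i<n. f i * cnj (f i)) = 1}"

text \<open>A power of the box is compact by Tychonoff, and the norm condition is closed because it
  involves finitely many continuous coordinates.\<close>

lemma compact_unit_functions: "compact (unit_functions n)"
proof -
  have "compact (PiE UNIV (\<lambda>_. unit_square) :: (nat \<Rightarrow> complex) set)"
    using compactin_PiE[of "\<lambda>_. euclidean" UNIV "\<lambda>_. unit_square"] compact_unit_square
    by (simp add: euclidean_product_topology)
  moreover have "closed {f :: nat \<Rightarrow> complex. (\<Sum>i<n. f i * cnj (f i)) = 1}"
    by (intro closed_Collect_eq continuous_intros continuous_on_product_coordinates)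
  ultimately have "compact (PiE UNIV (\<lambda>_. unit_square) \<inter> {f :: nat \<Rightarrow> complex. (\<Sum>i<n. f i * cnj (f i)) = 1})"
    by (rule compact_Int_closed)
  also have "PiE UNIV (\<lambda>_. unit_square) \<inter> {f :: nat \<Rightarrow> complex. (\<Sum>i<n. f i * cnj (f i)) = 1} = unit_functions n"
    by (auto simp: unit_functions_def PiE_def Pi_def)
  finally show ?thesis .
qed

lemma unit_functions_vec:
  "f \<in> unit_functions n \<Longrightarrow> unit_vector n (vec n f)"
  by (simp add: unit_functions_def unit_vector_def cscalar_sum[of _ n])

lemma vec_unit_functions:
  assumes x: "unit_vector n x"
  obtains f where "f \<in> unit_functions n" "x = vec n f"
proof
  \<comment> \<open>Padding with 0 keeps the function inside the box.\<close>
  let ?f = "\<lambda>i. if i < n then x $ i else 0"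
  have xc: "x \<in> carrier_vec n" and xx: "(\<Sum>i<n. x $ i * cnj (x $ i)) = 1"
    using x by (auto simp: unit_vector_def cscalar_sum)
  then have "of_real (\<Sum>i<n. (norm (x $ i))\<^sup>2) = (of_real 1 :: complex)"
    by (simp add: complex_norm_square del: of_real_power)
  then have sum1: "(\<Sum>i<n. (norm (x $ i))\<^sup>2) = 1" by (simp only: of_real_eq_iff)
  have "x $ i \<in> unit_square" if "i < n" for i
  proof -
    have "(norm (x $ i))\<^sup>2 \<le> 1"
      unfolding sum1[symmetric] using that by (intro member_le_sum) auto
    then have "norm (x $ i) \<le> 1" by (simp add: abs_square_le_1)
    then show ?thesis
      using abs_Re_le_cmod[of "x $ i"] abs_Im_le_cmod[of "x $ i"] by (simp add: unit_square_def)
  qed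
  then show "?f \<in> unit_functions n" using xx by (auto simp: unit_functions_def) (simp add: unit_square_def)
  show "x = vec n ?f" using xc by (intro eq_vecI) auto
qed

lemma unit_vector_exists: "0 < n \<Longrightarrow> \<exists>x. unit_vector n x"
  by (rule exI[of _ "unit_vec n 0"]) (simp add: unit_vector_def cscalar_sum[of _ n] unit_vec_def
      if_distrib[of cnj] if_distrib[of "\<lambda>z. _ * z"] cong: if_cong)

lemma unit_functions_nonempty: "0 < n \<Longrightarrow> unit_functions n \<noteq> {}"
  using unit_vector_exists[of n] by (auto elim: vec_unit_functions)

lemma product_overlap_attains_max:
  assumes X: "X \<in> carrier_mat (a * b) (a * b)" and "0 < a" "0 < b"
  obtains x y where "unit_vector a x" "unit_vector b y"
    and "\<And>x' y'. unit_vector a x' \<Longrightarrow> unit_vector b y' \<Longrightarrow>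
      overlap (tensor_vec x' y') X \<le> overlap (tensor_vec x y) X"
proof -
  define g where "g = (\<lambda>(f, h). overlap (tensor_vec (vec a f) (vec b h)) X)"
  \<comment> \<open>In this form \<open>g\<close> is visibly the real part of a polynomial in
    finitely many coordinates and their conjugates, hence continuous.\<close>
  have g_eq: "g z = Re (\<Sum>i<a. \<Sum>q<b. \<Sum>j<a. \<Sum>p<b. X $$ (i * b + q, j * b + p) *
      (fst z j * snd z p * cnj (fst z i * snd z q)))" for z
    by (cases z) (simp add: g_def overlap_def product_form_sum[OF X vec_carrier vec_carrier])
  let ?K = "unit_functions a \<times> unit_functions b"
  have "compact ?K" by (intro compact_Times compact_unit_functions)
  moreover have "?K \<noteq> {}"
    using unit_functions_nonempty \<open>0 < a\<close> \<open>0 < b\<close> by simp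
  moreover have "continuous_on ?K g"
  proof -
    have coord: "continuous_on ?K (\<lambda>z. fst z i)" "continuous_on ?K (\<lambda>z. snd z i)" for i
      by (rule continuous_on_product_then_coordinatewise[OF continuous_on_fst[OF continuous_on_id]],
          rule continuous_on_product_then_coordinatewise[OF continuous_on_snd[OF continuous_on_id]])
    show ?thesis
      unfolding g_eq[abs_def] by (intro continuous_on_Re continuous_on_sum continuous_on_mult
          continuous_on_cnj continuous_on_const coord)
  qed
  ultimately obtain z where z: "z \<in> ?K" and le: "\<And>z'. z' \<in> ?K \<Longrightarrow> g z' \<le> g z"
    using continuous_attains_sup[of ?K g] by blast
  show thesis
  proof
    show "unit_vector a (vec a (fst z))" "unit_vector b (vec b (snd z))"
      using z by (auto intro: unit_functions_vec)
    fix x' y' assume "unit_vector a x'" "unit_vector b y'"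
    then obtain f h where "f \<in> unit_functions a" "x' = vec a f" "h \<in> unit_functions b" "y' = vec b h"
      by (elim vec_unit_functions)
    then show "overlap (tensor_vec x' y') X \<le> overlap (tensor_vec (vec a (fst z)) (vec b (snd z))) X"
      using le[of "(f, h)"] by (cases z) (simp add: g_def)
  qed
qed

section \<open>From unit product vectors to all product vectors\<close>

lemma smult_form:
  fixes X :: "complex mat"
  assumes "X \<in> carrier_mat n n" "u \<in> carrier_vec n"
  shows "(X *\<^sub>v (z \<cdot>\<^sub>v u)) \<bullet>c (z \<cdot>\<^sub>v u) = z * cnj z * ((X *\<^sub>v u) \<bullet>c u)"
  using assms by (simp add: quadratic_form_sum[where n = n] sum_distrib_left mult_ac)

lemma tensor_vec_smult:
  "tensor_vec (s \<cdot>\<^sub>v x) (t \<cdot>\<^sub>v y) = (s * t) \<cdot>\<^sub>v tensor_vec x y"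
proof (rule eq_vecI)
  fix r assume "r < dim_vec ((s * t) \<cdot>\<^sub>v tensor_vec x y)"
  then have r: "r < dim_vec x * dim_vec y" by (simp add: tensor_vec_def)
  then have "0 < dim_vec y" by (auto intro: gr0I)
  then show "tensor_vec (s \<cdot>\<^sub>v x) (t \<cdot>\<^sub>v y) $ r = ((s * t) \<cdot>\<^sub>v tensor_vec x y) $ r"
    using r by (simp add: tensor_vec_def less_mult_imp_div_less)
qed (simp add: tensor_vec_def)

lemma tensor_unit_vector:
  assumes x: "unit_vector a x" and y: "unit_vector b y"
  shows "unit_vector (a * b) (tensor_vec x y)"
proof -
  have xc: "x \<in> carrier_vec a" and yc: "y \<in> carrier_vec b"
    and eq: "(\<Sum>i<a. x $ i * cnj (x $ i)) = 1" "(\<Sum>i<b. y $ i * cnj (y $ i)) = 1"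
    using x y by (auto simp: unit_vector_def cscalar_sum)
  have "tensor_vec x y \<bullet>c tensor_vec x y
    = (\<Sum>i<a. \<Sum>q<b. (x $ i * cnj (x $ i)) * (y $ q * cnj (y $ q)))"
    unfolding cscalar_sum[OF tensor_vec_carrier[OF xc yc]] sum_mult_lessThan
    by (intro sum.cong refl) (simp add: tensor_vec_index[OF xc yc])
  also have "\<dots> = 1" by (simp add: eq flip: sum_product)
  finally show ?thesis using xc yc by (simp add: unit_vector_def)
qed

lemma vec_polar:
  assumes "0 < n" and x: "x \<in> carrier_vec n"
  obtains s x' where "unit_vector n x'" "x = s \<cdot>\<^sub>v x'"
proof (cases "x = 0\<^sub>v n")
  case True
  \<comment> \<open>The zero vector is 0 times any unit vector, and one exists since
    \<open>n\<close> is positive.\<close>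
  obtain x' where x': "unit_vector n x'" using unit_vector_exists[OF \<open>0 < n\<close>] by blast
  then have "x = 0 \<cdot>\<^sub>v x'" using True by (intro eq_vecI) (auto simp: unit_vector_def)
  with x' show thesis by (rule that)
next
  case False
  define r where "r = Re (x \<bullet>c x)"
  have "x \<bullet>c x > 0" using conjugate_square_greater_0_vec[OF x] False by simp
  then have r: "x \<bullet>c x = of_real r" "0 < r"
    by (auto simp: r_def less_complex_def complex_eq_iff)
  let ?s = "of_real (sqrt r) :: complex"
  have s: "?s \<noteq> 0" "?s * ?s = of_real r" using r by (auto simp flip: of_real_mult)
  have "(inverse ?s \<cdot>\<^sub>v x) \<bullet>c (inverse ?s \<cdot>\<^sub>v x) = inverse (?s * ?s) * (x \<bullet>c x)"
    using x by (simp add: cscalar_sum[of _ n] sum_distrib_left mult_ac)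
  also have "\<dots> = 1" using s r by simp
  finally have "unit_vector n (inverse ?s \<cdot>\<^sub>v x)" using x by (simp add: unit_vector_def)
  moreover have "x = ?s \<cdot>\<^sub>v (inverse ?s \<cdot>\<^sub>v x)" using s(1) by (simp add: smult_smult_assoc)
  ultimately show thesis by (rule that)
qed

text \<open>Scaling the factors by \<open>s\<close> and \<open>t\<close> multiplies the form by the
  squared modulus of \<open>s * t\<close>. The bound by the maximum is known for unit vectors, and
  this extends it.\<close>

lemma block_positive_unit_vectors:
  assumes "0 < a" "0 < b" and X: "X \<in> carrier_mat (a * b) (a * b)"
    and pos: "\<And>x y. unit_vector a x \<Longrightarrow> unit_vector b y \<Longrightarrow>
      0 \<le> (X *\<^sub>v tensor_vec x y) \<bullet>c tensor_vec x y"
  shows "block_positive a b X"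
  unfolding block_positive_def
proof (intro conjI ballI)
  fix x y :: "complex vec" assume "x \<in> carrier_vec a" "y \<in> carrier_vec b"
  then obtain s t x' y' where x': "unit_vector a x'" "x = s \<cdot>\<^sub>v x'" and y': "unit_vector b y'" "y = t \<cdot>\<^sub>v y'"
    by (metis vec_polar[OF \<open>0 < a\<close>] vec_polar[OF \<open>0 < b\<close>])
  have "(X *\<^sub>v tensor_vec x y) \<bullet>c tensor_vec x y
    = (s * t) * cnj (s * t) * ((X *\<^sub>v tensor_vec x' y') \<bullet>c tensor_vec x' y')"
    unfolding x' y' tensor_vec_smult
    using x' y' by (intro smult_form[OF X]) (auto simp: unit_vector_def)
  also have "\<dots> \<ge> 0"
  proof (rule mult_nonneg_nonneg)
    show "0 \<le> (s * t) * cnj (s * t)"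
      unfolding complex_norm_square[symmetric] by (simp add: less_eq_complex_def del: of_real_power)
  qed (rule pos[OF x'(1) y'(1)])
  finally show "0 \<le> (X *\<^sub>v tensor_vec x y) \<bullet>c tensor_vec x y" .
qed (rule X)

section \<open>Local unitaries attain the bound and GLOCC maps obey it\<close>

text \<open>Rotating the state is the same as rotating the ground states backwards, so local
  unitaries range over overlaps with unit product vectors.\<close>

lemma overlap_local_unitaries:
  assumes U: "unitary_mat dA U" and V: "unitary_mat dB V"
    and v: "v \<in> carrier_vec dA" and w: "w \<in> carrier_vec dB"
    and X: "X \<in> carrier_mat (dA * dB) (dA * dB)"
  shows "overlap (tensor_vec v w) (tensor_mat U V * X * tensor_mat (mat_adjoint U) (mat_adjoint V)) =
    overlap (tensor_vec (mat_adjoint U *\<^sub>v v) (mat_adjoint V *\<^sub>v w)) X"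
proof -
  have Uc: "U \<in> carrier_mat dA dA" and Vc: "V \<in> carrier_mat dB dB"
    using U V by (auto simp: unitary_mat_def)
  show ?thesis
    unfolding overlap_def mat_adjoint_tensor[OF Uc Vc, symmetric]
      congruence_form[OF tensor_mat_carrier[OF Uc Vc] X tensor_vec_carrier[OF v w]]
    by (simp only: mat_adjoint_tensor[OF Uc Vc]
        tensor_mat_vec[OF mat_adjoint_carrier[OF Uc] mat_adjoint_carrier[OF Vc] v w])
qed

lemma local_unitaries_glocc:
  assumes "0 < dA" "0 < dB" and U: "unitary_mat dA U" and V: "unitary_mat dB V"
  shows "(\<lambda>X. tensor_mat U V * X * tensor_mat (mat_adjoint U) (mat_adjoint V)) \<in> glocc dA dB"
proof -
  let ?d = "dA * dB"
  have Uc: "U \<in> carrier_mat dA dA" and Vc: "V \<in> carrier_mat dB dB"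
    using U V by (auto simp: unitary_mat_def)
  note W = tensor_mat_carrier[OF Uc Vc]
    and W' = tensor_mat_carrier[OF mat_adjoint_carrier[OF Uc] mat_adjoint_carrier[OF Vc]]
  have "tensor_mat U V * tensor_mat (mat_adjoint U) (mat_adjoint V) = tensor_mat (1\<^sub>m dA) (1\<^sub>m dB)"
    using U V by (simp add: tensor_mat_mult[OF Uc Vc mat_adjoint_carrier[OF Uc] mat_adjoint_carrier[OF Vc]]
        unitary_mat_def)
  also have "\<dots> = 1\<^sub>m ?d"
  proof (rule eq_block_matI[where a = dA and b = dB and c = dA and d = dB])
    fix i q j p assume *: "i < dA" "q < dB" "j < dA" "p < dB"
    \<comment> \<open>Uniqueness of division with remainder: the Kronecker delta of composite
      indices is the product of the local ones.\<close>
    have "i * dB + q = j * dB + p \<longleftrightarrow> i = j \<and> q = p"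
      using * by (metis div_mult_self3 div_less add_0_right mod_mult_self3 mod_less gr_implies_not0)
    then show "tensor_mat (1\<^sub>m dA) (1\<^sub>m dB) $$ (i * dB + q, j * dB + p) = 1\<^sub>m ?d $$ (i * dB + q, j * dB + p)"
      using * by (simp add: tensor_mat_index[OF one_carrier_mat one_carrier_mat] pair_index_less)
  qed auto
  finally have "tensor_mat U V * maximally_mixed ?d * tensor_mat (mat_adjoint U) (mat_adjoint V)
      = maximally_mixed ?d"
    using W W' by (simp add: maximally_mixed_def mult_smult_distrib[OF W one_carrier_mat]
        mult_smult_assoc_mat[OF W W'])
  then show ?thesis
    using locc_local_unitaries[OF assms] by (simp add: glocc_def)
qed

lemma glocc_overlap_le:
  assumes "0 < dA" "0 < dB" and v: "unit_vector dA v" and w: "unit_vector dB w"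
    and \<rho>: "psd (dA * dB) \<rho>" and \<Lambda>: "\<Lambda> \<in> glocc dA dB"
    and M: "\<And>x y. unit_vector dA x \<Longrightarrow> unit_vector dB y \<Longrightarrow> overlap (tensor_vec x y) \<rho> \<le> M"
  shows "overlap (tensor_vec v w) (\<Lambda> \<rho>) \<le> M"
proof -
  \<comment> \<open>The factor \<open>dA * dB\<close> cancels the normalisation, so
    \<open>?m\<close> times the maximally mixed state is \<open>M \<cdot> 1\<close>.\<close>
  let ?d = "dA * dB" and ?m = "complex_of_real M * of_nat (dA * dB)"
  have \<Lambda>_locc: "locc dA dB dA dB \<Lambda>" and \<Lambda>_mixed: "\<Lambda> (maximally_mixed ?d) = maximally_mixed ?d"
    using \<Lambda> by (auto simp: glocc_def)
  note lin = locc_linear[OF \<Lambda>_locc]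
  \<comment> \<open>\<open>Y \<sigma>\<close> is \<open>M \<cdot> 1 - \<sigma>\<close>, written with
    the sum and scalar multiple that \<open>linear_mat_map\<close> speaks of.\<close>
  define Y where "Y = (\<lambda>\<sigma>. ?m \<cdot>\<^sub>m maximally_mixed ?d + (-1) \<cdot>\<^sub>m \<sigma>)"
  have mixed: "maximally_mixed ?d \<in> carrier_mat ?d ?d" by (simp add: maximally_mixed_def)
  have \<rho>c: "\<rho> \<in> carrier_mat ?d ?d" using \<rho> by (simp add: psd_def)
  have Y_form: "(Y \<sigma> *\<^sub>v u) \<bullet>c u = of_real M - (\<sigma> *\<^sub>v u) \<bullet>c u"
    if \<sigma>: "\<sigma> \<in> carrier_mat ?d ?d" and u: "unit_vector ?d u" for \<sigma> u
  proof -
    have uc: "u \<in> carrier_vec ?d" and uu: "(\<Sum>i<?d. u $ i * cnj (u $ i)) = 1"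
      using u by (auto simp: unit_vector_def cscalar_sum)
    have "(Y \<sigma> *\<^sub>v u) \<bullet>c u = (\<Sum>i<?d. \<Sum>j<?d.
        (if j = i then of_real M * (u $ i * cnj (u $ i)) else 0) - \<sigma> $$ (i, j) * (u $ j * cnj (u $ i)))"
      using \<sigma> assms(1,2)
      by (subst quadratic_form_sum[OF _ uc], simp add: Y_def)
        (auto simp: Y_def maximally_mixed_def algebra_simps intro!: sum.cong)
    also have "\<dots> = of_real M - (\<sigma> *\<^sub>v u) \<bullet>c u"
      by (simp add: sum_subtractf quadratic_form_sum[OF \<sigma> uc] uu flip: sum_distrib_left)
    finally show ?thesis .
  qed
  have "block_positive dA dB (Y \<rho>)"
  proof (rule block_positive_unit_vectors[OF \<open>0 < dA\<close> \<open>0 < dB\<close>])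
    show "Y \<rho> \<in> carrier_mat ?d ?d" using \<rho>c by (simp add: Y_def)
    fix x y assume xy: "unit_vector dA x" "unit_vector dB y"
    let ?u = "tensor_vec x y"
    note u = tensor_unit_vector[OF xy]
    \<comment> \<open>Positivity of \<open>\<rho>\<close> supplies that the form is real, which the
      complex order demands of the difference as well.\<close>
    have "0 \<le> (\<rho> *\<^sub>v ?u) \<bullet>c ?u" using \<rho> u by (auto simp: psd_def unit_vector_def)
    moreover have "Re ((\<rho> *\<^sub>v ?u) \<bullet>c ?u) \<le> M" using M[OF xy] by (simp add: overlap_def)
    ultimately show "0 \<le> (Y \<rho> *\<^sub>v ?u) \<bullet>c ?u"
      by (simp add: Y_form[OF \<rho>c u] less_eq_complex_def)
  qed
  then have "block_positive dA dB (\<Lambda> (Y \<rho>))" by (rule locc_block_positive[OF \<Lambda>_locc])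
  \<comment> \<open>Gibbs preservation enters here: \<open>\<Lambda>\<close> fixes the first summand
    of \<open>Y \<rho>\<close>.\<close>
  moreover have "\<Lambda> (Y \<rho>) = Y (\<Lambda> \<rho>)"
    using lin mixed \<rho>c by (simp add: Y_def linear_mat_map_def \<Lambda>_mixed)
  ultimately have "0 \<le> (Y (\<Lambda> \<rho>) *\<^sub>v tensor_vec v w) \<bullet>c tensor_vec v w"
    using v w by (auto simp: block_positive_def unit_vector_def)
  then show ?thesis
    using Y_form[OF linear_mat_map_carrier[OF lin \<rho>c] tensor_unit_vector[OF v w]]
    by (simp add: overlap_def less_eq_complex_def)
qed

theorem proposition1:
  fixes dA dB :: nat and v w :: "complex vec" and \<rho> :: "complex mat"
  assumes "0 < dA" and "0 < dB"
    and "unit_vector dA v" and "unit_vector dB w"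
    and "quantum_state (dA * dB) \<rho>"
  shows "is_maximum {overlap (tensor_vec v w) (\<Lambda> \<rho>) | \<Lambda>. \<Lambda> \<in> glocc dA dB} (F_max dA dB v w \<rho>)
    \<and> is_maximum
        {overlap (tensor_vec v w)
           (tensor_mat U V * \<rho> * tensor_mat (mat_adjoint U) (mat_adjoint V)) | U V.
           unitary_mat dA U \<and> unitary_mat dB V}
        (F_max dA dB v w \<rho>)"
    (is "is_maximum ?G _ \<and> is_maximum ?L _")
proof -
  have \<rho>: "psd (dA * dB) \<rho>" "\<rho> \<in> carrier_mat (dA * dB) (dA * dB)"
    using assms by (auto simp: quantum_state_def psd_def)
  obtain x y where x: "unit_vector dA x" and y: "unit_vector dB y"
    and max: "\<And>x' y'. unit_vector dA x' \<Longrightarrow> unit_vector dB y' \<Longrightarrow>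
      overlap (tensor_vec x' y') \<rho> \<le> overlap (tensor_vec x y) \<rho>"
    using product_overlap_attains_max[OF \<rho>(2) assms(1,2)] by metis
  let ?M = "overlap (tensor_vec x y) \<rho>"
  have vw: "v \<in> carrier_vec dA" "w \<in> carrier_vec dB" using assms by (auto simp: unit_vector_def)
  \<comment> \<open>Adjoints appear because conjugating the state by \<open>U \<otimes> V\<close>
    takes the ground states to their images under the adjoints.\<close>
  obtain U V where U: "unitary_mat dA U" "mat_adjoint U *\<^sub>v v = x"
    and V: "unitary_mat dB V" "mat_adjoint V *\<^sub>v w = y"
    by (metis unitary_transitive x y assms(3,4))
  have "?M \<in> ?L" using overlap_local_unitaries[OF U(1) V(1) vw \<rho>(2)] U V by force
  \<comment> \<open>Since \<open>?M\<close> lies in the smaller set and bounds the larger one, it is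
    the maximum of both.\<close>
  moreover have "?L \<subseteq> ?G" using local_unitaries_glocc[OF assms(1,2)] by fast
  moreover have "\<forall>m\<in>?G. m \<le> ?M"
    using glocc_overlap_le[OF assms(1-4) \<rho>(1) _ max] by blast
  ultimately have G: "is_maximum ?G ?M" and L: "is_maximum ?L ?M"
    by (auto simp: is_maximum_def)
  \<comment> \<open>A maximum is unique by antisymmetry, so the definite description denotes
    \<open>?M\<close>.\<close>
  have "F_max dA dB v w \<rho> = ?M"
    unfolding F_max_def using G by (intro the_equality) (auto simp: is_maximum_def intro: antisym)
  with G L show ?thesis by simp
qed

end
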